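(* Let $X,Y$ be Banach spaces and $T\in\mathcal L(X,Y)$ a bounded linear operator. The following are equivalent: (i) $T$ is not Tauberian; (ii) there exists a wide-$(s)$ sequence $(x_j)$ in $X$ with $(Tx_j)$ norm-convergent; (iii) there exists a wide-$(c)$ sequence $(e_j)$ in $X$ with $\sum_j\|Te_j\|<\infty$.
   Context: $X$ is regarded as a subspace of $X^{**}$ canonically. $T\in\mathcal L(X,Y)$ is Tauberian if $T^{**}(X^{**}\setminus X)\subset Y^{**}\setminus Y$. A sequence is semi-normalized if $0<\inf_j\|b_j\|\le\sup_j\|b_j\|<\infty$. A semi-normalized sequence $(b_j)$ is wide-$(s)$ if it is a basic sequence such that $\sum_j c_j$ converges whenever $\sum_j c_jb_j$ converges. A semi-normalized sequence $(e_j)$ is wide-$(c)$ if it is a basic sequence with $\sup_n\|\sum_{j=1}^n e_j\|<\infty$. *)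

theory Defs
  imports "HOL-Analysis.Analysis"
begin

definition canon :: "'a::real_normed_vector \<Rightarrow> (('a \<Rightarrow>\<^sub>L real) \<Rightarrow>\<^sub>L real)" where
  "canon x = Blinfun (\<lambda>f. blinfun_apply f x)"

definition bidual_op :: "('a::real_normed_vector \<Rightarrow>\<^sub>L 'b::real_normed_vector)
    \<Rightarrow> (('a \<Rightarrow>\<^sub>L real) \<Rightarrow>\<^sub>L real) \<Rightarrow> (('b \<Rightarrow>\<^sub>L real) \<Rightarrow>\<^sub>L real)" where
  "bidual_op T \<phi> = Blinfun (\<lambda>g. blinfun_apply \<phi> (g o\<^sub>L T))"

definition tauberian :: "('a::real_normed_vector \<Rightarrow>\<^sub>L 'b::real_normed_vector) \<Rightarrow> bool" where
  "tauberian T \<longleftrightarrow> bidual_op T ` (UNIV - range canon) \<subseteq> UNIV - range canon"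

definition semi_normalized :: "(nat \<Rightarrow> 'a::real_normed_vector) \<Rightarrow> bool" where
  "semi_normalized b \<longleftrightarrow> (\<exists>a>0. \<forall>j. a \<le> norm (b j)) \<and> (\<exists>M. \<forall>j. norm (b j) \<le> M)"

definition basic_seq :: "(nat \<Rightarrow> 'a::real_normed_vector) \<Rightarrow> bool" where
  "basic_seq b \<longleftrightarrow> (\<forall>x \<in> closure (span (range b)).
      \<exists>!c::nat \<Rightarrow> real. (\<lambda>j. c j *\<^sub>R b j) sums x)"

definition wide_s :: "(nat \<Rightarrow> 'a::real_normed_vector) \<Rightarrow> bool" where
  "wide_s b \<longleftrightarrow> semi_normalized b \<and> basic_seq b \<and>
     (\<forall>c::nat \<Rightarrow> real. summable (\<lambda>j. c j *\<^sub>R b j) \<longrightarrow> summable c)"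

definition wide_c :: "(nat \<Rightarrow> 'a::real_normed_vector) \<Rightarrow> bool" where
  "wide_c e \<longleftrightarrow> semi_normalized e \<and> basic_seq e \<and>
     (\<exists>M. \<forall>n. norm (\<Sum>j<n. e j) \<le> M)"

end

theory Submission
  imports Defs
begin

text \<open>
  If \<open>T\<close> is not Tauberian, some \<open>\<phi>\<close> in the bidual, at positive distance from \<open>X\<close>, is mapped into \<open>Y\<close>,
  say to \<open>y\<close>.  By a version of Goldstine's theorem one chooses successively \<open>x\<^sub>n\<close> in \<open>X\<close> with
  \<open>\<parallel>T x\<^sub>n - y\<parallel> \<le> 2\<^sup>-\<^sup>n\<close> and \<open>x\<^sub>n - \<phi>\<close> almost annihilating a finite set of functionals that almost norms
  the span of \<open>\<phi>, x\<^sub>0, \<dots>, x\<^sub>n\<^sub>-\<^sub>1\<close>.  Then \<open>\<phi>, x\<^sub>0 - \<phi>, x\<^sub>1 - \<phi>, \<dots>\<close> is basic, which makes \<open>x\<close> wide-(s) and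
  its difference sequence wide-(c).

  Conversely, let \<open>x\<close> be wide-(s), or the sequence of partial sums of a wide-(c) sequence, with \<open>T x\<^sub>n\<close>
  convergent.  By Hahn-Banach the limit functional extends to some \<open>\<phi>\<close> in the bidual, with \<open>T\<^sup>*\<^sup>* \<phi>\<close>
  in \<open>Y\<close>.  If \<open>\<phi>\<close> came from some \<open>u\<close> in \<open>X\<close>, the uniform bounds on the basis projections (Baire) would
  give \<open>u = 0\<close> in the first case and norm convergence of the partial sums to \<open>u\<close> in the second, and
  both are impossible.
\<close>

subsection \<open>Sublinear functions and the Hahn-Banach theorem\<close>

definition sublinear :: "('v::real_vector \<Rightarrow> real) \<Rightarrow> bool" where
  "sublinear p \<longleftrightarrow> (\<forall>x y. p (x + y) \<le> p x + p y) \<and> (\<forall>t\<ge>0. \<forall>x. p (t *\<^sub>R x) = t * p x)"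

lemma sublinear_add: "sublinear p \<Longrightarrow> p (x + y) \<le> p x + p y"
  and sublinear_scaleR: "sublinear p \<Longrightarrow> 0 \<le> t \<Longrightarrow> p (t *\<^sub>R x) = t * p x"
  by (auto simp: sublinear_def)

lemma sublinear_zero: "sublinear p \<Longrightarrow> p 0 = 0"
  using sublinear_scaleR[of p 0 0] by simp

lemma sublinear_minus_le: "sublinear p \<Longrightarrow> - p (- x) \<le> p x"
  using sublinear_add[of p x "- x"] sublinear_zero[of p] by simp

lemma sublinear_norm: "0 \<le> C \<Longrightarrow> sublinear (\<lambda>x. C * norm (x::'v::real_normed_vector))"
proof -
  assume "0 \<le> C"
  then have "C * norm (x + y) \<le> C * norm x + C * norm y" for x y :: 'v
    by (metis distrib_left mult_left_mono norm_triangle_ineq)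
  then show ?thesis by (auto simp: sublinear_def)
qed

text \<open>The infimal convolution of \<open>b\<close> with the image of \<open>a\<close> under
  \<open>A\<close>. Under the assumptions of \<open>sandwich\<close>, a linear functional lies below
  it exactly if it lies below \<open>b\<close> and its composition with \<open>A\<close> lies below
  \<open>a\<close> on \<open>K\<close>.\<close>

definition inf_conv :: "'u set \<Rightarrow> ('u \<Rightarrow> 'v) \<Rightarrow> ('u \<Rightarrow> real) \<Rightarrow> ('v::real_vector \<Rightarrow> real) \<Rightarrow> 'v \<Rightarrow> real"
  where "inf_conv K A a b v = (INF u\<in>K. a u + b (v - A u))"

text \<open>The data of a Hahn-Banach problem: a linear \<open>l\<close> below \<open>b\<close> is
  sought with \<open>l (A u) \<le> a u\<close> on the cone \<open>K\<close>. Adding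
  \<open>l (A u) \<le> a u\<close> and \<open>l (- A u) \<le> b (- A u)\<close> shows that
  \<open>nonneg\<close> is necessary; \<open>ex_linear_between\<close> shows that it suffices. Each
  extension and separation below is an instance with a suitable cone.\<close>

locale sandwich =
  fixes K :: "'u::real_vector set" and A :: "'u \<Rightarrow> 'v::real_vector"
    and a :: "'u \<Rightarrow> real" and b :: "'v \<Rightarrow> real"
  assumes zero_K: "0 \<in> K"
    and add_K: "\<And>u v. u \<in> K \<Longrightarrow> v \<in> K \<Longrightarrow> u + v \<in> K"
    and scaleR_K: "\<And>t u. 0 \<le> t \<Longrightarrow> u \<in> K \<Longrightarrow> t *\<^sub>R u \<in> K"
    and linear_A: "linear A"
    and a_add: "\<And>u v. u \<in> K \<Longrightarrow> v \<in> K \<Longrightarrow> a (u + v) \<le> a u + a v"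
    and a_scaleR: "\<And>t u. 0 \<le> t \<Longrightarrow> u \<in> K \<Longrightarrow> a (t *\<^sub>R u) = t * a u"
    and b_sublinear: "sublinear b"
    and nonneg: "\<And>u. u \<in> K \<Longrightarrow> 0 \<le> a u + b (- A u)"
begin

lemma inf_conv_bdd: "bdd_below ((\<lambda>u. a u + b (v - A u)) ` K)"
proof (rule bdd_belowI2)
  fix u assume "u \<in> K"
  \<comment> \<open>Subadditivity splits off a term free of \<open>u\<close>; \<open>nonneg\<close>
    absorbs the rest.\<close>
  have "b (- A u) \<le> b (v - A u) + b (- v)"
    using sublinear_add[OF b_sublinear, of "v - A u" "- v"] by simp
  with nonneg[OF \<open>u \<in> K\<close>] show "- b (- v) \<le> a u + b (v - A u)" by linarith
qed

lemma inf_conv_le: "u \<in> K \<Longrightarrow> inf_conv K A a b v \<le> a u + b (v - A u)"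
  unfolding inf_conv_def by (rule cINF_lower[OF inf_conv_bdd])

lemma inf_conv_greatest: "(\<And>u. u \<in> K \<Longrightarrow> m \<le> a u + b (v - A u)) \<Longrightarrow> m \<le> inf_conv K A a b v"
  unfolding inf_conv_def using zero_K by (intro cINF_greatest) auto

lemma inf_conv_sublinear: "sublinear (inf_conv K A a b)"
proof -
  interpret A: linear A by (rule linear_A)
  let ?p = "inf_conv K A a b"
  have add: "?p (x + y) \<le> ?p x + ?p y" for x y
  proof -
    have "?p (x + y) - (a u + b (x - A u)) \<le> ?p y" if u: "u \<in> K" for u
    proof (rule inf_conv_greatest)
      fix v assume v: "v \<in> K"
      have "?p (x + y) \<le> a (u + v) + b ((x + y) - A (u + v))"
        by (rule inf_conv_le[OF add_K[OF u v]])
      also have "(x + y) - A (u + v) = (x - A u) + (y - A v)"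
        by (simp add: A.add)
      finally show "?p (x + y) - (a u + b (x - A u)) \<le> a v + b (y - A v)"
        using a_add[OF u v] sublinear_add[OF b_sublinear, of "x - A u" "y - A v"] by linarith
    qed
    then have "?p (x + y) - ?p y \<le> a u + b (x - A u)" if "u \<in> K" for u
      using that by (simp add: diff_le_eq add.commute)
    then have "?p (x + y) - ?p y \<le> ?p x" by (rule inf_conv_greatest)
    then show ?thesis by simp
  qed
  have scale_le: "?p (t *\<^sub>R x) \<le> t * ?p x" if t: "0 < t" for t x
  proof -
    have "?p (t *\<^sub>R x) / t \<le> ?p x"
    proof (rule inf_conv_greatest)
      fix u assume u: "u \<in> K"
      have "?p (t *\<^sub>R x) \<le> a (t *\<^sub>R u) + b (t *\<^sub>R x - A (t *\<^sub>R u))"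
        using t u by (intro inf_conv_le scaleR_K) auto
      also have "t *\<^sub>R x - A (t *\<^sub>R u) = t *\<^sub>R (x - A u)"
        by (simp add: A.scaleR scaleR_diff_right)
      also have "a (t *\<^sub>R u) + b \<dots> = t * (a u + b (x - A u))"
        using t u by (simp add: a_scaleR sublinear_scaleR[OF b_sublinear] distrib_left)
      finally show "?p (t *\<^sub>R x) / t \<le> a u + b (x - A u)"
        using t by (simp add: field_simps)
    qed
    then show ?thesis using t by (simp add: field_simps)
  qed
  have scale: "?p (t *\<^sub>R x) = t * ?p x" if t: "0 < t" for t x
  proof (rule antisym[OF scale_le[OF t]])
    \<comment> \<open>The reverse inequality is \<open>scale_le\<close> for the factor
      \<open>1 / t\<close>.\<close>
    have "?p ((1 / t) *\<^sub>R (t *\<^sub>R x)) \<le> (1 / t) * ?p (t *\<^sub>R x)"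
      using t by (intro scale_le) simp
    then show "t * ?p x \<le> ?p (t *\<^sub>R x)" using t by (simp add: field_simps)
  qed
  have "?p 0 = 0"
    using scale[of 2 0] by simp
  with scale have "?p (t *\<^sub>R x) = t * ?p x" if "0 \<le> t" for t x
    using that by (cases "t = 0") auto
  with add show ?thesis by (auto simp: sublinear_def)
qed

lemma inf_conv_le_right: "inf_conv K A a b v \<le> b v"
proof -
  interpret A: linear A by (rule linear_A)
  show ?thesis
    using inf_conv_le[OF zero_K, of v] a_scaleR[of 0 0] zero_K by (simp add: A.zero)
qed

lemma inf_conv_le_left: "u \<in> K \<Longrightarrow> inf_conv K A a b (A u) \<le> a u"
  using inf_conv_le[of u "A u"] sublinear_zero[OF b_sublinear] by simp

end

text \<open>A minimal sublinear function is odd, since otherwise subtracting the ray through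
  \<^term>\<open>x\<close> by infimal convolution would make it smaller.\<close>

lemma minimal_sublinear_imp_linear:
  assumes q: "sublinear q"
    and minimal: "\<And>q'. sublinear q' \<Longrightarrow> (\<And>x. q' x \<le> q x) \<Longrightarrow> q' = q"
  shows "linear q"
proof -
  have odd: "q (- x) = - q x" for x
  proof -
    \<comment> \<open>The cone is the ray through \<open>- x\<close>, with the linear value
      \<open>- q x\<close> prescribed at \<open>- x\<close>; \<open>nonneg\<close> holds with
      equality because \<open>q\<close> is positively homogeneous.\<close>
    interpret sandwich "{0..}" "\<lambda>t. t *\<^sub>R (- x)" "\<lambda>t. - t * q x" q
    proof (rule sandwich.intro)
      show "linear (\<lambda>t. t *\<^sub>R (- x))"
        by (intro linearI) (auto simp: algebra_simps)
    qed (auto simp: q sublinear_scaleR[OF q] algebra_simps)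
    have "inf_conv {0..} (\<lambda>t. t *\<^sub>R (- x)) (\<lambda>t. - t * q x) q = q"
      by (rule minimal[OF inf_conv_sublinear inf_conv_le_right])
    with inf_conv_le_left[of 1] have "q (- x) \<le> - q x" by simp
    with sublinear_minus_le[OF q, of x] show ?thesis by simp
  qed
  show ?thesis
  proof (rule linearI)
    fix x y
    have "q x \<le> q (x + y) + q (- y)" using sublinear_add[OF q, of "x + y" "- y"] by simp
    then show "q (x + y) = q x + q y" using odd[of y] sublinear_add[OF q, of x y] by linarith
  next
    fix t x
    show "q (t *\<^sub>R x) = t *\<^sub>R q x"
    proof (cases "0 \<le> t")
      case True
      then show ?thesis by (simp add: sublinear_scaleR[OF q])
    next
      case False
      then have "q ((- t) *\<^sub>R x) = - t * q x" by (intro sublinear_scaleR[OF q]) simp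
      with odd[of "t *\<^sub>R x"] show ?thesis by simp
    qed
  qed
qed

text \<open>By Zorn's lemma there is a minimal sublinear function below \<open>p\<close>, and
  minimality forces linearity. Chains are bounded below by their pointwise infimum.\<close>

theorem ex_linear_le_sublinear:
  assumes p: "sublinear p"
  shows "\<exists>l. linear l \<and> (\<forall>x. l x \<le> p x)"
proof -
  let ?A = "{q. sublinear q \<and> q \<le> p}"
  \<comment> \<open>The order is reversed, so the maximal element of Zorn's lemma is a minimal
    function.\<close>
  let ?P = "\<lambda>q r :: 'a \<Rightarrow> real. r \<le> q"
  have "\<exists>m\<in>?A. \<forall>q\<in>?A. ?P m q \<longrightarrow> q = m"
  proof (rule predicate_Zorn)
    show "partial_order_on ?A (relation_of ?P ?A)"
      by (rule partial_order_on_relation_ofI) auto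
  next
    fix C assume "C \<in> Chains (relation_of ?P ?A)"
    then have C: "sublinear q" "q \<le> p" "r \<in> C \<Longrightarrow> q \<le> r \<or> r \<le> q" if "q \<in> C" for q r
      using that unfolding Chains_def relation_of_def by auto
    show "\<exists>u\<in>?A. \<forall>q\<in>C. ?P q u"
    proof (cases "C = {}")
      case True
      then show ?thesis using p by auto
    next
      case False
      define u where "u x = (INF q\<in>C. q x)" for x
      \<comment> \<open>The lower bound \<open>- p (- x)\<close> is common to all members of the
        chain.\<close>
      have bdd: "bdd_below ((\<lambda>q. q x) ` C)" for x
      proof (rule bdd_belowI2)
        fix q assume q: "q \<in> C"
        show "- p (- x) \<le> q x"
          using sublinear_minus_le[OF C(1)[OF q], of x] le_funD[OF C(2)[OF q], of "- x"] by linarith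
      qed
      have lower: "u x \<le> q x" if "q \<in> C" for q x
        unfolding u_def by (rule cINF_lower[OF bdd that])
      have greatest: "m \<le> u x" if "\<And>q. q \<in> C \<Longrightarrow> m \<le> q x" for m x
        unfolding u_def using False that by (intro cINF_greatest) auto
      have "u (x + y) \<le> u x + u y" for x y
      proof -
        have "u (x + y) \<le> q x + r y" if q: "q \<in> C" and r: "r \<in> C" for q r
        proof -
          \<comment> \<open>The smaller of \<open>q\<close> and \<open>r\<close> bounds both
            summands; only here the chain property enters.\<close>
          obtain s where s: "s \<in> C" "s \<le> q" "s \<le> r"
            using C(3)[OF q r] q r by (metis order_refl)
          have "u (x + y) \<le> s x + s y"
            using lower[OF s(1), of "x + y"] sublinear_add[OF C(1)[OF s(1)], of x y] by linarith
          then show ?thesis using le_funD[OF s(2), of x] le_funD[OF s(3), of y] by linarith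
        qed
        then have "u (x + y) - q x \<le> u y" if "q \<in> C" for q
          using that by (intro greatest) (smt (verit))
        then have "u (x + y) - u y \<le> u x"
          by (intro greatest) (simp add: diff_le_eq add.commute)
        then show ?thesis by simp
      qed
      moreover have "u (t *\<^sub>R x) = t * u x" if t: "0 \<le> t" for t x
      proof (cases "t = 0")
        case True
        have "(\<lambda>q. q (0::'a)) ` C = {0}"
          using False sublinear_zero[OF C(1)] by (auto simp: image_iff)
        with True show ?thesis by (simp add: u_def)
      next
        case False
        with t have t: "0 < t" by simp
        have "u (t *\<^sub>R x) / t \<le> u x"
        proof (rule greatest)
          fix q assume q: "q \<in> C"
          show "u (t *\<^sub>R x) / t \<le> q x"
            using lower[OF q, of "t *\<^sub>R x"] t sublinear_scaleR[OF C(1)[OF q], of t x]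
            by (simp add: field_simps)
        qed
        moreover have "t * u x \<le> u (t *\<^sub>R x)"
        proof (rule greatest)
          fix q assume q: "q \<in> C"
          show "t * u x \<le> q (t *\<^sub>R x)"
            using lower[OF q, of x] t sublinear_scaleR[OF C(1)[OF q], of t x] by simp
        qed
        ultimately show ?thesis using t by (simp add: field_simps)
      qed
      ultimately have "sublinear u" by (simp add: sublinear_def)
      moreover have "u \<le> q" if "q \<in> C" for q
        using lower[OF that] by (simp add: le_fun_def)
      ultimately show ?thesis using False C(2) by (blast intro: order_trans)
    qed
  qed
  then obtain m where m: "sublinear m" "m \<le> p" "\<And>q. sublinear q \<Longrightarrow> q \<le> p \<Longrightarrow> q \<le> m \<Longrightarrow> q = m"
    by auto
  have "linear m"
    by (rule minimal_sublinear_imp_linear[OF m(1)]) (blast intro: m order_trans[OF _ m(2)] le_funI)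
  with m(2) show ?thesis by (auto simp: le_fun_def)
qed

theorem (in sandwich) ex_linear_between:
  "\<exists>l. linear l \<and> (\<forall>v. l v \<le> b v) \<and> (\<forall>u\<in>K. l (A u) \<le> a u)"
  using ex_linear_le_sublinear[OF inf_conv_sublinear] inf_conv_le_left inf_conv_le_right
  by (meson order_trans)

subsection \<open>Duals and biduals\<close>

lemma linear_le_norm_imp_blinfun:
  fixes l :: "'a::real_normed_vector \<Rightarrow> real"
  assumes l: "linear l" and le: "\<And>x. l x \<le> C * norm x" and C: "0 \<le> C"
  obtains f :: "'a \<Rightarrow>\<^sub>L real" where "\<And>x. f x = l x" "norm f \<le> C"
proof -
  have abs_le: "norm (l x) \<le> C * norm x" for x
    using le[of x] le[of "- x"] linear_neg[OF l, of x] by simp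
  then have "bounded_linear l"
    by (intro bounded_linear_intro[where K = C]) (simp_all add: linear_add[OF l] linear_scale[OF l] mult.commute)
  then have ap: "blinfun_apply (Blinfun l) x = l x" for x
    by (simp add: bounded_linear_Blinfun_apply)
  moreover have "norm (Blinfun l) \<le> C"
    using abs_le C by (intro norm_blinfun_bound) (simp_all add: ap)
  ultimately show thesis by (rule that)
qed

section \<open>Separating points from subspaces\<close>

lemma subspace_dist_scaleR:
  fixes x :: "'a::real_normed_vector"
  assumes M: "subspace M" and d: "\<And>u. u \<in> M \<Longrightarrow> d \<le> norm (x - u)" and u: "u \<in> M"
  shows "\<bar>t\<bar> * d \<le> norm (t *\<^sub>R x + u)"
proof (cases "t = 0")
  case False
  have "d \<le> norm (x - (- 1 / t) *\<^sub>R u)"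
    by (intro d subspace_scale[OF M] u)
  then have "\<bar>t\<bar> * d \<le> \<bar>t\<bar> * norm (x - (- 1 / t) *\<^sub>R u)"
    by (intro mult_left_mono) auto
  also have "\<dots> = norm (t *\<^sub>R (x - (- 1 / t) *\<^sub>R u))"
    by simp
  also have "t *\<^sub>R (x - (- 1 / t) *\<^sub>R u) = t *\<^sub>R x + u"
    using False by (simp add: scaleR_add_right)
  finally show ?thesis .
qed auto

lemma ex_blinfun_separating_subspace:
  fixes x :: "'a::real_normed_vector"
  assumes M: "subspace M" and d: "0 \<le> d" "\<And>u. u \<in> M \<Longrightarrow> d \<le> norm (x - u)"
  obtains f :: "'a \<Rightarrow>\<^sub>L real" where "norm f \<le> 1" "\<And>u. u \<in> M \<Longrightarrow> f u = 0" "d \<le> f x"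
proof -
  \<comment> \<open>The cone imposes \<open>l (u - t *\<^sub>R x) \<le> - t * d\<close>. For
    \<open>t = 0\<close> this makes \<open>l\<close> vanish on \<open>M\<close>, since
    \<open>M\<close> is symmetric; for \<open>u = 0\<close> and \<open>t = 1\<close> it gives
    \<open>d \<le> l x\<close>.\<close>
  interpret sandwich "M \<times> {0..}" "\<lambda>(u, t). u - t *\<^sub>R x" "\<lambda>(u, t). - t * d" "\<lambda>v. 1 * norm v"
  proof (rule sandwich.intro)
    show "linear (\<lambda>(u, t). u - t *\<^sub>R x)"
      by (rule linearI) (auto simp: algebra_simps)
    show "sublinear (\<lambda>v::'a. 1 * norm v)" by (rule sublinear_norm) simp
  next
    fix p :: "'a \<times> real" assume "p \<in> M \<times> {0..}"
    then obtain u t where p: "p = (u, t)" "u \<in> M" "0 \<le> t" by auto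
    have "t * d \<le> norm (t *\<^sub>R x - u)"
      using subspace_dist_scaleR[OF M d(2) subspace_neg[OF M p(2)], of t] p(3) by simp
    then show "0 \<le> (case p of (u, t) \<Rightarrow> - t * d) + 1 * norm (- (case p of (u, t) \<Rightarrow> u - t *\<^sub>R x))"
      by (simp add: p)
  qed (use M in \<open>auto simp: subspace_add subspace_scale subspace_0 zero_prod_def algebra_simps\<close>)
  obtain l where l: "linear l" "\<And>v. l v \<le> 1 * norm v"
    "\<And>u t. u \<in> M \<Longrightarrow> 0 \<le> t \<Longrightarrow> l (u - t *\<^sub>R x) \<le> - t * d"
    using ex_linear_between by (auto simp: Ball_def)
  obtain f :: "'a \<Rightarrow>\<^sub>L real" where f: "\<And>x. f x = l x" "norm f \<le> 1"
    using linear_le_norm_imp_blinfun[OF l(1,2)] by auto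
  have "f u = 0" if "u \<in> M" for u
    using l(3)[OF that, of 0] l(3)[OF subspace_neg[OF M that], of 0] linear_neg[OF l(1), of u]
    by (simp add: f)
  moreover have "d \<le> f x"
    using l(3)[OF subspace_0[OF M], of 1] linear_neg[OF l(1), of x] by (simp add: f)
  ultimately show thesis using that f(2) by blast
qed

lemma ex_norming_blinfun:
  fixes x :: "'a::real_normed_vector"
  obtains f :: "'a \<Rightarrow>\<^sub>L real" where "norm f \<le> 1" "f x = norm x"
proof -
  obtain f :: "'a \<Rightarrow>\<^sub>L real" where f: "norm f \<le> 1" "norm x \<le> f x"
    by (rule ex_blinfun_separating_subspace[of "{0}" "norm x" x]) auto
  have "f x \<le> norm f * norm x"
    using norm_blinfun[of f x] by simp
  also have "\<dots> \<le> norm x"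
    using f(1) by (simp add: mult_left_le_one_le)
  finally show thesis using that f by force
qed

text \<open>A point outside the closure has positive distance from \<open>M\<close>, and the
  separating functional of that size contradicts the assumption.\<close>

lemma in_closure_subspace_by_functionals:
  fixes x :: "'a::real_normed_vector"
  assumes M: "subspace M" and f: "\<And>f :: 'a \<Rightarrow>\<^sub>L real. (\<And>u. u \<in> M \<Longrightarrow> f u = 0) \<Longrightarrow> f x = 0"
  shows "x \<in> closure M"
proof (rule ccontr)
  assume "x \<notin> closure M"
  moreover have "M \<noteq> {}" using subspace_0[OF M] by auto
  ultimately have pos: "0 < infdist x M"
    using in_closure_iff_infdist_zero[of M x] infdist_nonneg[of x M] by force
  have "infdist x M \<le> norm (x - u)" if "u \<in> M" for u
    using infdist_le[OF that, of x] by (simp add: dist_norm)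
  then obtain f :: "'a \<Rightarrow>\<^sub>L real" where "\<And>u. u \<in> M \<Longrightarrow> f u = 0" "infdist x M \<le> f x"
    using ex_blinfun_separating_subspace[OF M infdist_nonneg[of x M], of x] by metis
  with f[of f] pos show False by simp
qed

section \<open>The canonical embedding and functionals on the dual\<close>

lemma canon_apply [simp]: "blinfun_apply (canon x) f = blinfun_apply f x"
  unfolding canon_def by (subst bounded_linear_Blinfun_apply) (auto intro: bounded_linear_intros)

lemma bidual_op_apply [simp]: "blinfun_apply (bidual_op T \<phi>) g = \<phi> (g o\<^sub>L T)"
proof -
  have "bounded_linear (\<lambda>g. \<phi> (g o\<^sub>L T))"
    by (intro bounded_linear_intros)
  then show ?thesis by (simp add: bidual_op_def bounded_linear_Blinfun_apply)
qed

lemma norm_canon [simp]: "norm (canon x) = norm x"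
proof (rule antisym)
  show "norm (canon x) \<le> norm x"
    by (rule norm_blinfun_bound) (auto simp: mult.commute[of "norm x"] norm_blinfun simp del: real_norm_def)
  obtain f where f: "norm f \<le> 1" "blinfun_apply f x = norm x"
    by (rule ex_norming_blinfun)
  have "norm x \<le> norm (canon x) * norm f"
    using norm_blinfun[of "canon x" f] f by simp
  also have "\<dots> \<le> norm (canon x)" using f(1) by (simp add: mult_right_le_one_le)
  finally show "norm x \<le> norm (canon x)" .
qed

lemma linear_canon: "linear canon"
  by (rule linearI) (auto intro!: blinfun_eqI simp: blinfun.bilinear_simps)

lemma canon_sum_scaleR: "canon (\<Sum>j\<in>J. c j *\<^sub>R x j) = (\<Sum>j\<in>J. c j *\<^sub>R canon (x j))"
  by (simp add: linear_sum[OF linear_canon] linear_scale[OF linear_canon])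

text \<open>An isometric image of a complete space is complete. This gives elements of the bidual
  outside \<open>X\<close> a positive distance from \<open>X\<close>.\<close>

lemma closed_range_canon: "closed (range (canon :: 'a::banach \<Rightarrow> _))"
proof -
  have "bounded_linear (canon :: 'a \<Rightarrow> _)"
    by (rule bounded_linear_intro[where K = 1])
       (auto simp: linear_add[OF linear_canon] linear_scale[OF linear_canon])
  then have "complete (canon ` (UNIV :: 'a set))"
    by (intro complete_isometric_image[of 1]) (auto simp: complete_UNIV)
  then show ?thesis by (simp add: complete_eq_closed)
qed

text \<open>A substitute for a weak-star cluster point of the sequence: Hahn-Banach extends the
  limit functional, which is defined only on those \<open>f\<close> for which the limit
  exists.\<close>

lemma ex_weak_cluster_functional:
  fixes x :: "nat \<Rightarrow> 'a::real_normed_vector"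
  assumes bound: "\<And>n. norm (x n) \<le> M"
  obtains \<phi> :: "('a \<Rightarrow>\<^sub>L real) \<Rightarrow>\<^sub>L real"
  where "\<And>f r. (\<lambda>n. blinfun_apply f (x n)) \<longlonglongrightarrow> r \<Longrightarrow> \<phi> f = r"
proof -
  have M: "0 \<le> M" using bound[of 0] norm_ge_zero order_trans by blast
  \<comment> \<open>The pairs in this cone together express that \<open>l f\<close> is at most the
    limit superior of \<open>f (x n)\<close>.\<close>
  let ?K = "{(f, a). \<forall>\<^sub>F n in sequentially. blinfun_apply f (x n) \<le> a}"
  interpret sandwich ?K fst snd "\<lambda>f. M * norm f"
  proof (rule sandwich.intro)
    show "p + q \<in> ?K" if "p \<in> ?K" "q \<in> ?K" for p q :: "('a \<Rightarrow>\<^sub>L real) \<times> real"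
    proof -
      obtain f a g b where pq: "p = (f, a)" "q = (g, b)" by fastforce
      have "\<forall>\<^sub>F n in sequentially. blinfun_apply f (x n) \<le> a"
        "\<forall>\<^sub>F n in sequentially. blinfun_apply g (x n) \<le> b" using that pq by auto
      then have "\<forall>\<^sub>F n in sequentially. blinfun_apply (f + g) (x n) \<le> a + b"
        by eventually_elim (simp add: blinfun.add_left)
      then show ?thesis by (simp add: pq)
    qed
    show "t *\<^sub>R p \<in> ?K" if t: "0 \<le> t" and "p \<in> ?K" for t and p :: "('a \<Rightarrow>\<^sub>L real) \<times> real"
    proof -
      obtain f a where p: "p = (f, a)" by fastforce
      have "\<forall>\<^sub>F n in sequentially. blinfun_apply f (x n) \<le> a" using that p by auto
      then have "\<forall>\<^sub>F n in sequentially. blinfun_apply (t *\<^sub>R f) (x n) \<le> t * a"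
        by eventually_elim (simp add: blinfun.scaleR_left mult_left_mono t)
      then show ?thesis by (simp add: p)
    qed
    show "0 \<le> snd p + M * norm (- fst p)" if "p \<in> ?K" for p :: "('a \<Rightarrow>\<^sub>L real) \<times> real"
    proof -
      have "\<forall>\<^sub>F n in sequentially. blinfun_apply (fst p) (x n) \<le> snd p"
        using that by (auto simp: case_prod_beta)
      then obtain n where n: "blinfun_apply (fst p) (x n) \<le> snd p"
        by (auto simp: eventually_sequentially)
      have "- blinfun_apply (fst p) (x n) \<le> norm (fst p) * norm (x n)"
        using norm_blinfun[of "fst p" "x n"] by simp
      also have "\<dots> \<le> norm (fst p) * M" by (intro mult_left_mono bound) simp
      finally show ?thesis using n by (simp add: mult.commute)
    qed
  qed (auto simp: linear_fst sublinear_norm M zero_prod_def)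
  obtain l where l: "linear l" "\<And>f. l f \<le> M * norm f"
    "\<And>f a. \<forall>\<^sub>F n in sequentially. blinfun_apply f (x n) \<le> a \<Longrightarrow> l f \<le> a"
    using ex_linear_between by auto
  obtain \<phi> :: "('a \<Rightarrow>\<^sub>L real) \<Rightarrow>\<^sub>L real" where \<phi>: "\<And>f. \<phi> f = l f"
    using linear_le_norm_imp_blinfun[OF l(1,2) M] by auto
  have le: "\<phi> f \<le> r" if lim: "(\<lambda>n. blinfun_apply f (x n)) \<longlonglongrightarrow> r" for f r
  proof (rule field_le_epsilon)
    fix e :: real assume "0 < e"
    then have "\<forall>\<^sub>F n in sequentially. blinfun_apply f (x n) < r + e"
      by (intro order_tendstoD(2)[OF lim]) simp
    then show "\<phi> f \<le> r + e"
      unfolding \<phi> by (intro l(3)) (auto elim: eventually_mono)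
  qed
  have "\<phi> f = r" if lim: "(\<lambda>n. blinfun_apply f (x n)) \<longlonglongrightarrow> r" for f r
  proof (rule antisym[OF le[OF lim]])
    have "\<phi> (- f) \<le> - r"
      by (rule le) (use tendsto_minus[OF lim] in \<open>simp add: blinfun.minus_left\<close>)
    then show "r \<le> \<phi> f" by (simp add: blinfun.minus_right)
  qed
  then show thesis by (rule that)
qed

text \<open>A functional vanishing on the common kernel of finitely many functionals is a linear
  combination of them. Here they are evaluations, so the combination is itself evaluation at one
  element \<open>h\<close> of the dual.\<close>

lemma functional_of_finite_evaluations:
  fixes F :: "('a::real_normed_vector \<Rightarrow>\<^sub>L real) set"
    and m :: "(('a \<Rightarrow>\<^sub>L real) \<Rightarrow>\<^sub>L real) \<Rightarrow> real"
  assumes "finite F" "linear m" "\<And>\<psi>. (\<And>f. f \<in> F \<Longrightarrow> blinfun_apply \<psi> f = 0) \<Longrightarrow> m \<psi> = 0"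
  shows "\<exists>h. \<forall>\<psi>. m \<psi> = blinfun_apply \<psi> h"
  using assms
proof (induction F arbitrary: m rule: finite_induct)
  case empty
  then show ?case by (intro exI[of _ 0]) simp
next
  case (insert f F)
  show ?case
  proof (cases "\<forall>\<psi> :: ('a \<Rightarrow>\<^sub>L real) \<Rightarrow>\<^sub>L real. (\<forall>g\<in>F. blinfun_apply \<psi> g = 0) \<longrightarrow> blinfun_apply \<psi> f = 0")
    case True
    have "m \<psi> = 0" if "\<And>g. g \<in> F \<Longrightarrow> blinfun_apply \<psi> g = 0" for \<psi>
      using True that by (intro insert.prems(2)) auto
    then show ?thesis by (rule insert.IH[OF insert.prems(1)])
  next
    case False
    then obtain \<psi>0 :: "('a \<Rightarrow>\<^sub>L real) \<Rightarrow>\<^sub>L real" where \<psi>0: "\<And>g. g \<in> F \<Longrightarrow> blinfun_apply \<psi>0 g = 0" "blinfun_apply \<psi>0 f \<noteq> 0"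
      by blast
    \<comment> \<open>Subtracting \<open>k\<close> times the evaluation at \<open>f\<close> kills
      \<psi>0, which spans the kernel of \<open>F\<close> modulo that of \<open>insert f F\<close>;
      so \<open>F\<close> alone suffices for the rest.\<close>
    define k where "k = m \<psi>0 / \<psi>0 f"
    have "\<exists>h. \<forall>\<psi>. m \<psi> - k * \<psi> f = blinfun_apply \<psi> h"
    proof (rule insert.IH)
      show "linear (\<lambda>\<psi>. m \<psi> - k * blinfun_apply \<psi> f)"
        using insert.prems(1)
        by (intro linearI) (auto simp: linear_add linear_scale blinfun.bilinear_simps algebra_simps)
    next
      fix \<psi> :: "('a \<Rightarrow>\<^sub>L real) \<Rightarrow>\<^sub>L real" assume \<psi>: "\<And>g. g \<in> F \<Longrightarrow> blinfun_apply \<psi> g = 0"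
      have "m (\<psi> - (\<psi> f / \<psi>0 f) *\<^sub>R \<psi>0) = 0"
        using \<psi> \<psi>0 by (intro insert.prems(2)) (auto simp: blinfun.bilinear_simps)
      then show "m \<psi> - k * \<psi> f = 0"
        using insert.prems(1) by (simp add: linear_diff linear_scale k_def)
    qed
    then obtain h where h: "\<And>\<psi>. m \<psi> - k * \<psi> f = blinfun_apply \<psi> h" by blast
    then have "m \<psi> = blinfun_apply \<psi> (h + k *\<^sub>R f)" for \<psi>
      by (simp add: blinfun.bilinear_simps flip: h)
    then show ?thesis by blast
  qed
qed

text \<open>Goldstine's theorem, strengthened: since \<open>T\<^sup>*\<^sup>* \<phi>\<close> lies in the target space, the approximating
  vector can be chosen with image close to it in norm.\<close>

lemma goldstine_operator:
  fixes T :: "'a::real_normed_vector \<Rightarrow>\<^sub>L 'b::real_normed_vector"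
  assumes y: "bidual_op T \<phi> = canon y" and F: "finite F" and \<epsilon>: "0 < \<epsilon>" and R: "norm \<phi> < R"
  shows "\<exists>x. norm x \<le> R \<and> norm (T x - y) \<le> \<epsilon> \<and> (\<forall>f\<in>F. \<bar>blinfun_apply f x - \<phi> f\<bar> \<le> \<epsilon>)"
proof (rule ccontr)
  assume contra: "\<not> ?thesis"
  have R0: "0 < R" using R norm_ge_zero[of \<phi>] by linarith
  \<comment> \<open>Scaled so that, if no good \<open>x\<close> exists, \<open>q\<close> is at least
    1 at \<open>(y - T w, \<phi> - canon w)\<close> for each \<open>w\<close> in the ball of radius
    \<open>R\<close>.\<close>
  define q where "q = (\<lambda>(v::'b, \<psi>::('a \<Rightarrow>\<^sub>L real) \<Rightarrow>\<^sub>L real). (norm v + (\<Sum>f\<in>F. \<bar>\<psi> f\<bar>)) / \<epsilon>)"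
  have q_sublinear: "sublinear q"
  proof -
    have "q (p + r) \<le> q p + q r" for p r
    proof -
      obtain u \<psi> v \<theta> where pr: "p = (u, \<psi>)" "r = (v, \<theta>)" by fastforce
      have "(\<Sum>f\<in>F. \<bar>(\<psi> + \<theta>) f\<bar>) \<le> (\<Sum>f\<in>F. \<bar>\<psi> f\<bar> + \<bar>\<theta> f\<bar>)"
        by (intro sum_mono) (simp add: blinfun.add_left abs_triangle_ineq)
      then have "norm (u + v) + (\<Sum>f\<in>F. \<bar>(\<psi> + \<theta>) f\<bar>)
          \<le> (norm u + (\<Sum>f\<in>F. \<bar>\<psi> f\<bar>)) + (norm v + (\<Sum>f\<in>F. \<bar>\<theta> f\<bar>))"
        using norm_triangle_ineq[of u v] by (simp add: sum.distrib)
      then show ?thesis using \<epsilon> by (simp add: q_def pr divide_right_mono flip: add_divide_distrib)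
    qed
    moreover have "q (t *\<^sub>R p) = t * q p" if "0 \<le> t" for t p
      using that by (cases p) (simp add: q_def blinfun.scaleR_left abs_mult sum_distrib_left distrib_left)
    ultimately show ?thesis by (simp add: sublinear_def)
  qed
  let ?A = "\<lambda>(x, t). (T x - t *\<^sub>R y, canon x - t *\<^sub>R \<phi>)"
  \<comment> \<open>At \<open>t = 0\<close> the cone bounds \<open>l (T x, canon x)\<close> by
    \<open>norm x / R\<close>; at \<open>x = 0\<close> and \<open>t = 1\<close> it gives
    \<open>1 \<le> l (y, \<phi>)\<close>. The condition \<open>nonneg\<close> reduces by homogeneity
    to \<open>t = 1\<close>, where \<open>contra\<close> applies.\<close>
  interpret sandwich "UNIV \<times> {0..}" ?A "\<lambda>(x, t). norm x / R - t" q
  proof (rule sandwich.intro)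
    show "linear ?A"
      by (rule linearI) (auto simp: blinfun.bilinear_simps linear_add[OF linear_canon]
          linear_scale[OF linear_canon] algebra_simps)
  next
    fix p p' :: "'a \<times> real"
    show "(case p + p' of (x, t) \<Rightarrow> norm x / R - t)
       \<le> (case p of (x, t) \<Rightarrow> norm x / R - t) + (case p' of (x, t) \<Rightarrow> norm x / R - t)"
      using R0 by (cases p; cases p')
        (simp add: divide_right_mono norm_triangle_ineq flip: add_divide_distrib)
  next
    fix p :: "'a \<times> real" assume "p \<in> UNIV \<times> {0..}"
    then obtain x t where p: "p = (x, t)" "0 \<le> t" by auto
    show "0 \<le> (case p of (x, t) \<Rightarrow> norm x / R - t) + q (- ?A p)"
    proof (cases "t = 0")
      case True
      have "0 \<le> q z" for z using \<epsilon> by (cases z) (simp add: q_def sum_nonneg)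
      with True show ?thesis using R0 by (simp add: p)
    next
      case False
      with p have t: "0 < t" by simp
      define w where "w = (1 / t) *\<^sub>R x"
      have x: "x = t *\<^sub>R w" using t by (simp add: w_def)
      let ?z = "(y - T w, \<phi> - canon w)"
      have "1 \<le> norm w / R + q ?z"
      proof (cases "norm w \<le> R")
        case True
        have "\<epsilon> \<le> norm (y - T w) + (\<Sum>f\<in>F. \<bar>\<phi> f - f w\<bar>)"
        proof (cases "norm (T w - y) \<le> \<epsilon>")
          case True
          with \<open>norm w \<le> R\<close> contra obtain f where f: "f \<in> F" "\<epsilon> < \<bar>blinfun_apply f w - \<phi> f\<bar>"
            by (meson not_le)
          then have "\<epsilon> \<le> (\<Sum>f\<in>F. \<bar>\<phi> f - f w\<bar>)"
            using member_le_sum[of f F "\<lambda>f. \<bar>\<phi> f - f w\<bar>"] F by (simp add: abs_minus_commute)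
          then show ?thesis using norm_ge_zero[of "y - T w"] by linarith
        next
          case False
          then have "\<epsilon> \<le> norm (y - T w)" by (simp add: norm_minus_commute)
          moreover have "0 \<le> (\<Sum>f\<in>F. \<bar>\<phi> f - f w\<bar>)" by (rule sum_nonneg) simp
          ultimately show ?thesis by linarith
        qed
        then have "1 \<le> q ?z" using \<epsilon> by (simp add: q_def blinfun.diff_left)
        moreover have "0 \<le> norm w / R" using R0 by simp
        ultimately show ?thesis by linarith
      next
        case False
        then have "1 \<le> norm w / R" using R0 by simp
        moreover have "0 \<le> q ?z" using \<epsilon> by (simp add: q_def sum_nonneg)
        ultimately show ?thesis by linarith
      qed
      then have "t * 1 \<le> t * (norm w / R + q ?z)" using t by (intro mult_left_mono) auto
      also have "\<dots> = norm x / R + q (t *\<^sub>R ?z)"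
        using t by (simp add: x distrib_left sublinear_scaleR[OF q_sublinear] del: scaleR_Pair)
      also have "t *\<^sub>R ?z = - ?A p"
        by (simp add: p x blinfun.bilinear_simps scaleR_diff_right linear_scale[OF linear_canon])
      finally show ?thesis by (simp add: p)
    qed
  qed (use R0 q_sublinear in \<open>auto simp: zero_prod_def algebra_simps\<close>)
  obtain l where l: "linear l" "\<And>z. l z \<le> q z"
    "\<And>x t. 0 \<le> t \<Longrightarrow> l (?A (x, t)) \<le> norm x / R - t"
    using ex_linear_between by (auto simp: Ball_def)
  have "linear (\<lambda>v. l (v, 0))"
    using linear_add[OF l(1)] linear_scale[OF l(1)] by (intro linearI) (metis add.right_neutral add_Pair, metis scaleR_Pair scaleR_zero_right)
  moreover have "l (v, 0) \<le> 1 / \<epsilon> * norm v" for v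
    using l(2)[of "(v, 0)"] by (simp add: q_def)
  moreover have "0 \<le> 1 / \<epsilon>" using \<epsilon> by simp
  ultimately obtain g :: "'b \<Rightarrow>\<^sub>L real" where g: "\<And>v. g v = l (v, 0)"
    using linear_le_norm_imp_blinfun[of "\<lambda>v. l (v, 0)"] by blast
  \<comment> \<open>As \<open>q\<close> sees its second argument only through \<open>F\<close>, so
    does \<open>l\<close>; hence that part of \<open>l\<close> is represented in the dual itself and
    not only in the third dual.\<close>
  have "\<exists>h. \<forall>\<psi>. l (0, \<psi>) = blinfun_apply \<psi> h"
  proof (rule functional_of_finite_evaluations[OF F])
    show "linear (\<lambda>\<psi>. l (0, \<psi>))"
      using linear_add[OF l(1)] linear_scale[OF l(1)] by (intro linearI) (metis add.right_neutral add_Pair, metis scaleR_Pair scaleR_zero_right)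
    fix \<psi> :: "('a \<Rightarrow>\<^sub>L real) \<Rightarrow>\<^sub>L real" assume "\<And>f. f \<in> F \<Longrightarrow> \<psi> f = 0"
    then have "q (0, \<psi>) = 0" "q (0, - \<psi>) = 0" by (auto simp: q_def blinfun.minus_left)
    then show "l (0, \<psi>) = 0"
      using l(2)[of "(0, \<psi>)"] l(2)[of "(0, - \<psi>)"] linear_neg[OF l(1), of "(0, \<psi>)"] by simp
  qed
  then obtain h where h: "\<And>\<psi>. l (0, \<psi>) = blinfun_apply \<psi> h" by blast
  have split: "l (v, \<psi>) = g v + \<psi> h" for v \<psi>
    using linear_add[OF l(1), of "(v, 0)" "(0, \<psi>)"] by (simp add: g h)
  \<comment> \<open>On \<open>(T x, canon x)\<close> the functional \<open>l\<close> acts as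
    \<open>k\<close>, so \<open>norm k \<le> 1 / R\<close>. Since \<open>y\<close> represents the
    bidual image of \<phi>, also \<open>l (y, \<phi>) = \<phi> k\<close>, which is then less than
    1.\<close>
  define k where "k = (g o\<^sub>L T) + h"
  have "blinfun_apply k x \<le> 1 / R * norm x" for x
    using l(3)[of 0 x] by (simp add: split k_def blinfun.add_left)
  then have "\<bar>blinfun_apply k x\<bar> \<le> 1 / R * norm x" for x
    by (metis abs_le_iff blinfun.minus_right norm_minus_cancel)
  then have "norm k \<le> 1 / R"
    using R0 by (intro norm_blinfun_bound) auto
  have "1 \<le> l (y, \<phi>)"
    using l(3)[of 1 0] linear_neg[OF l(1), of "(y, \<phi>)"] by (simp add: linear_0[OF linear_canon])
  also have "\<dots> = \<phi> k"
    using arg_cong[OF y, of "\<lambda>\<psi>. blinfun_apply \<psi> g"] by (simp add: split k_def blinfun.add_right)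
  also have "\<dots> \<le> norm \<phi> * norm k" using norm_blinfun[of \<phi> k] by simp
  also have "\<dots> \<le> norm \<phi> * (1 / R)" using \<open>norm k \<le> 1 / R\<close> by (intro mult_left_mono) auto
  also have "\<dots> < 1" using R R0 by simp
  finally show False by simp
qed

subsection \<open>Approximating an element of the bidual by a basic sequence\<close>

lemma closed_if_compact_Int_cball:
  fixes S :: "'a::real_normed_vector set"
  assumes "\<And>r. compact (S \<inter> cball 0 r)"
  shows "closed S"
  unfolding closed_sequential_limits
proof (intro allI impI, elim conjE)
  fix x l assume x: "\<forall>n. x n \<in> S" and lim: "x \<longlonglongrightarrow> l"
  then obtain r where "\<And>n. norm (x n) \<le> r"
    using convergent_imp_Bseq[of x] by (auto simp: Bseq_def convergent_def)
  with x have "\<forall>n. x n \<in> S \<inter> cball 0 r" by simp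
  with lim compact_imp_closed[OF assms[of r]] have "l \<in> S \<inter> cball 0 r"
    unfolding closed_sequential_limits by blast
  then show "l \<in> S" by simp
qed

text \<open>A new vector \<open>b\<close> has positive distance \<open>d\<close> from the old span,
  which is closed by induction. This bounds the coefficient of \<open>b\<close>, and the ball
  becomes part of the continuous image of a compact product.\<close>

lemma compact_span_Int_cball:
  fixes B :: "'a::real_normed_vector set"
  assumes "finite B"
  shows "compact (span B \<inter> cball 0 r)"
  using assms
proof (induction B arbitrary: r rule: finite_induct)
  case empty
  then show ?case by (simp add: finite_imp_compact)
next
  case (insert b B)
  show ?case
  proof (cases "b \<in> span B")
    case True
    then show ?thesis using insert by (simp add: span_redundant)
  next
    case False
    define d where "d = infdist b (span B)"
    have "closed (span B)" by (rule closed_if_compact_Int_cball[OF insert.IH])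
    moreover have "span B \<noteq> {}" using span_zero by blast
    ultimately have d: "0 < d"
      unfolding d_def using False by (simp add: infdist_pos_not_in_closed)
    have d_le: "\<bar>t\<bar> * d \<le> norm (t *\<^sub>R b + u)" if "u \<in> span B" for t u
      using that infdist_le[of _ "span B" b]
      by (intro subspace_dist_scaleR[of "span B"]) (auto simp: d_def dist_norm)
    let ?g = "\<lambda>(t, u). t *\<^sub>R b + u"
    \<comment> \<open>Bounds the component in \<open>span B\<close> once the coefficient of
      \<open>b\<close> is at most \<open>r / d\<close>.\<close>
    let ?R = "r + r / d * norm b"
    let ?P = "{- (r / d)..r / d} \<times> (span B \<inter> cball 0 ?R)"
    have "span (insert b B) \<inter> cball 0 r = ?g ` ?P \<inter> cball 0 r"
    proof (intro equalityI subsetI)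
      fix x assume x: "x \<in> span (insert b B) \<inter> cball 0 r"
      then obtain t where t: "x - t *\<^sub>R b \<in> span B" by (auto simp: span_insert)
      define u where "u = x - t *\<^sub>R b"
      have xu: "x = t *\<^sub>R b + u" by (simp add: u_def)
      have "\<bar>t\<bar> * d \<le> r" using d_le[OF t, of t] x by simp
      then have tr: "\<bar>t\<bar> \<le> r / d" using d by (simp add: field_simps)
      have "norm u \<le> norm x + \<bar>t\<bar> * norm b"
        unfolding u_def using norm_triangle_ineq4[of x "t *\<^sub>R b"] by simp
      also have "\<dots> \<le> ?R" using x tr by (intro add_mono mult_right_mono) auto
      finally have "(t, u) \<in> ?P" using tr t by (auto simp: u_def abs_le_iff)
      with x xu show "x \<in> ?g ` ?P \<inter> cball 0 r" by auto
    next
      fix x assume "x \<in> ?g ` ?P \<inter> cball 0 r"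
      then show "x \<in> span (insert b B) \<inter> cball 0 r"
        by (auto intro!: span_add span_scale intro: span_base span_mono[THEN subsetD, of B])
    qed
    moreover have "compact (?g ` ?P)"
      by (intro compact_continuous_image compact_Times insert.IH compact_Icc)
         (auto simp: case_prod_beta intro!: continuous_intros)
    ultimately show ?thesis by (simp add: compact_Int_closed)
  qed
qed

text \<open>The open sets on which a fixed \<open>f\<close> is almost norming cover the compact unit
  sphere of \<open>E\<close>; a finite subcover yields \<open>F\<close>.\<close>

lemma ex_finite_almost_norming:
  fixes E :: "('v::real_normed_vector \<Rightarrow>\<^sub>L real) set"
  assumes "compact (E \<inter> sphere 0 1)" "\<epsilon> > 0"
  obtains F :: "'v set" where "finite F" "\<And>f. f \<in> F \<Longrightarrow> norm f \<le> 1"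
    "\<And>e. e \<in> E \<Longrightarrow> norm e = 1 \<Longrightarrow> \<exists>f\<in>F. 1 - \<epsilon> < blinfun_apply e f"
proof -
  let ?U = "\<lambda>f. {e :: 'v \<Rightarrow>\<^sub>L real. 1 - \<epsilon> < blinfun_apply e f}"
  have "E \<inter> sphere 0 1 \<subseteq> (\<Union>f\<in>cball 0 1. ?U f)"
  proof
    fix e assume e: "e \<in> E \<inter> sphere 0 1"
    show "e \<in> (\<Union>f\<in>cball 0 1. ?U f)"
    proof (rule ccontr)
      assume contra: "e \<notin> (\<Union>f\<in>cball 0 1. ?U f)"
      have le: "blinfun_apply e f \<le> 1 - \<epsilon>" if "norm f \<le> 1" for f
        using contra that by (auto simp: not_less)
      have le': "blinfun_apply e f \<le> (1 - \<epsilon>) * norm f" for f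
      proof (cases "f = 0")
        case False
        then show ?thesis
          using le[of "(1 / norm f) *\<^sub>R f"] by (simp add: blinfun.scaleR_right field_simps)
      qed simp
      have "norm (blinfun_apply e f) \<le> (1 - \<epsilon>) * norm f" for f
        using le'[of f] le'[of "- f"] by (simp add: blinfun.minus_right abs_le_iff)
      moreover have "0 \<le> 1 - \<epsilon>" using le[of 0] by simp
      ultimately have "norm e \<le> 1 - \<epsilon>" by (intro norm_blinfun_bound)
      with e \<open>\<epsilon> > 0\<close> show False by simp
    qed
  qed
  moreover have "open (?U f)" for f
    by (intro open_Collect_less continuous_intros)
  ultimately obtain F where F: "F \<subseteq> cball 0 1" "finite F" "E \<inter> sphere 0 1 \<subseteq> (\<Union>f\<in>F. ?U f)"
    using compactE_image[OF assms(1), of "cball 0 1" ?U] by (metis (lifting))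
  show thesis
  proof (rule that[OF F(2)])
    show "norm f \<le> 1" if "f \<in> F" for f
      using F(1) that by auto
    show "\<exists>f\<in>F. 1 - \<epsilon> < blinfun_apply e f" if "e \<in> E" "norm e = 1" for e
      using F(3) that by (auto dest!: subsetD[of _ _ e])
  qed
qed

text \<open>Mazur's step in the construction of a basic sequence: \<open>canon x - \<phi>\<close> is
  nearly annihilated by functionals that almost norm \<open>span B\<close>, while its norm is at
  least \<open>d\<close>, so adding multiples of it hardly shortens vectors of
  \<open>span B\<close>.\<close>

lemma ex_next_term:
  fixes T :: "'a::real_normed_vector \<Rightarrow>\<^sub>L 'b::real_normed_vector"
  assumes y: "bidual_op T \<phi> = canon y" and d: "0 < d" "\<And>x. d \<le> norm (\<phi> - canon x)"
    and B: "finite B" and \<epsilon>: "0 < \<epsilon>" "\<epsilon> \<le> 1" and \<eta>: "0 < \<eta>"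
  shows "\<exists>x. norm x \<le> norm \<phi> + 1 \<and> norm (T x - y) \<le> \<eta> \<and>
    (\<forall>e\<in>span B. \<forall>t. (1 - \<epsilon>) * norm e \<le> norm (e + t *\<^sub>R (canon x - \<phi>)))"
proof -
  have closed_unit_sphere: "closed (sphere (0 :: ('a \<Rightarrow>\<^sub>L real) \<Rightarrow>\<^sub>L real) 1)"
    unfolding sphere_def by (intro closed_Collect_eq continuous_intros)
  have "span B \<inter> sphere 0 1 = (span B \<inter> cball 0 1) \<inter> sphere 0 1" by auto
  then have cpt: "compact (span B \<inter> sphere 0 1)"
    using compact_Int_closed[OF compact_span_Int_cball[OF B, of 1] closed_unit_sphere] by metis
  obtain F where F: "finite F" "\<And>f. f \<in> F \<Longrightarrow> norm f \<le> 1"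
    "\<And>e. e \<in> span B \<Longrightarrow> norm e = 1 \<Longrightarrow> \<exists>f\<in>F. 1 - \<epsilon> / 2 < blinfun_apply e f"
    using ex_finite_almost_norming[OF cpt, of "\<epsilon> / 2"] \<epsilon> by (metis half_gt_zero)
  \<comment> \<open>The factor \<open>d * \<epsilon> / 4\<close> makes the error
    \<open>\<bar>t\<bar> * \<delta>\<close> at most \<epsilon>/2 as long as
    \<open>\<bar>t\<bar> * d \<le> 2\<close>.\<close>
  define \<delta> where "\<delta> = min \<eta> (d * \<epsilon> / 4)"
  have \<delta>: "0 < \<delta>" using d \<epsilon> \<eta> by (simp add: \<delta>_def)
  obtain x where x: "norm x \<le> norm \<phi> + 1" "norm (T x - y) \<le> \<delta>"
    "\<And>f. f \<in> F \<Longrightarrow> \<bar>blinfun_apply f x - \<phi> f\<bar> \<le> \<delta>"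
    using goldstine_operator[OF y F(1) \<delta>, of "norm \<phi> + 1"] by auto
  define w where "w = canon x - \<phi>"
  have unit: "1 - \<epsilon> \<le> norm (e + t *\<^sub>R w)" if e: "e \<in> span B" "norm e = 1" for e t
  \<comment> \<open>For small \<open>t\<close> an almost norming \<open>f\<close> decides; for large
    \<open>t\<close> the norm of \<open>t *\<^sub>R w\<close> exceeds 2 and outweighs the unit
    vector \<open>e\<close>.\<close>
  proof (cases "\<bar>t\<bar> * d \<le> 2")
    case True
    obtain f where f: "f \<in> F" "1 - \<epsilon> / 2 < blinfun_apply e f" using F(3)[OF e] by blast
    have "\<bar>t * blinfun_apply w f\<bar> \<le> \<bar>t\<bar> * \<delta>"
      using x(3)[OF f(1)] by (simp add: abs_mult w_def blinfun.diff_left mult_left_mono)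
    also have "\<dots> \<le> \<bar>t\<bar> * (d * \<epsilon> / 4)" by (intro mult_left_mono) (auto simp: \<delta>_def)
    also have "\<dots> = (\<bar>t\<bar> * d) * (\<epsilon> / 4)" by simp
    also have "\<dots> \<le> 2 * (\<epsilon> / 4)" using True \<epsilon> by (intro mult_right_mono) auto
    finally have "1 - \<epsilon> \<le> blinfun_apply (e + t *\<^sub>R w) f"
      using f(2) by (simp add: blinfun.bilinear_simps)
    also have "\<dots> \<le> norm (e + t *\<^sub>R w) * norm f"
      using norm_blinfun[of "e + t *\<^sub>R w" f] by simp
    also have "\<dots> \<le> norm (e + t *\<^sub>R w)"
      using F(2)[OF f(1)] by (simp add: mult_right_le_one_le)
    finally show ?thesis .
  next
    case False
    have "d \<le> norm w" using d(2)[of x] by (simp add: w_def norm_minus_commute)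
    then have "\<bar>t\<bar> * d \<le> norm (t *\<^sub>R w)" by (simp add: mult_left_mono)
    moreover have "norm (t *\<^sub>R w) \<le> norm (e + t *\<^sub>R w) + norm e"
      using norm_triangle_ineq4[of "e + t *\<^sub>R w" e] by simp
    ultimately show ?thesis using False e \<epsilon> by linarith
  qed
  have "(1 - \<epsilon>) * norm e \<le> norm (e + t *\<^sub>R w)" if e: "e \<in> span B" for e t
  proof (cases "e = 0")
    case False
    have "1 - \<epsilon> \<le> norm ((1 / norm e) *\<^sub>R e + (t / norm e) *\<^sub>R w)"
      using False by (intro unit span_scale e) auto
    also have "(1 / norm e) *\<^sub>R e + (t / norm e) *\<^sub>R w = (1 / norm e) *\<^sub>R (e + t *\<^sub>R w)"
      by (simp add: scaleR_add_right)
    also have "norm \<dots> = norm (e + t *\<^sub>R w) / norm e" by simp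
    finally show ?thesis using False by (simp add: field_simps)
  qed auto
  moreover have "norm (T x - y) \<le> \<eta>" using x(2) by (simp add: \<delta>_def)
  ultimately show ?thesis using x(1) unfolding w_def by blast
qed

text \<open>The two properties of a wide-(s) sequence \<^term>\<open>x\<close> in quantitative form are
  \<open>dominates x x\<close> and \<open>dominates x (\<lambda>_. 1)\<close>.\<close>

definition dominates :: "(nat \<Rightarrow> 'a::real_normed_vector) \<Rightarrow> (nat \<Rightarrow> 'b::real_normed_vector) \<Rightarrow> bool" where
  "dominates x z \<longleftrightarrow> (\<exists>C\<ge>0. \<forall>(c::nat \<Rightarrow> real) n m. n \<le> m \<longrightarrow>
     norm (\<Sum>j<n. c j *\<^sub>R z j) \<le> C * norm (\<Sum>j<m. c j *\<^sub>R x j))"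

lemma dominatesE:
  assumes "dominates x z"
  obtains C where "0 \<le> C" "\<And>(c::nat \<Rightarrow> real) n m. n \<le> m \<Longrightarrow>
     norm (\<Sum>j<n. c j *\<^sub>R z j) \<le> C * norm (\<Sum>j<m. c j *\<^sub>R x j)"
  using assms unfolding dominates_def by blast

lemma dominatesI:
  assumes "0 \<le> C" "\<And>(c::nat \<Rightarrow> real) n m. n \<le> m \<Longrightarrow>
     norm (\<Sum>j<n. c j *\<^sub>R z j) \<le> C * norm (\<Sum>j<m. c j *\<^sub>R x j)"
  shows "dominates x z"
  using assms unfolding dominates_def by blast

text \<open>The vectors \<^term>\<open>x n\<close> are chosen such that \<open>\<phi>, x\<^sub>0 - \<phi>, x\<^sub>1 - \<phi>, \<dots>\<close> is basic in the
  bidual; the positive distance of \<^term>\<open>\<phi>\<close> from the original space transfers this to \<^term>\<open>x\<close>.\<close>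

lemma not_tauberian_imp_sequence:
  fixes T :: "'a::banach \<Rightarrow>\<^sub>L 'b::real_normed_vector"
  assumes "\<not> tauberian T"
  obtains x :: "nat \<Rightarrow> 'a" and y M where "\<And>n. norm (x n) \<le> M"
    "\<And>n. norm (T (x n) - y) \<le> (1/2) ^ n" "dominates x x" "dominates x (\<lambda>_. 1::real)"
proof -
  obtain \<phi> y where \<phi>: "\<phi> \<notin> range canon" and y: "bidual_op T \<phi> = canon y"
    using assms by (auto simp: tauberian_def)
  define d where "d = infdist \<phi> (range canon)"
  have d: "0 < d"
    unfolding d_def using \<phi> by (intro infdist_pos_not_in_closed closed_range_canon) auto
  have d_le: "d \<le> norm (\<phi> - canon x)" for x
    unfolding d_def using infdist_le[of "canon x" "range canon" \<phi>] by (simp add: dist_norm)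
  \<comment> \<open>The losses allowed at the single steps are the ratios
    \<open>g (Suc n) / g n\<close>; their products telescope and stay above 1/2, so the basis
    constant is at most 2.\<close>
  define g :: "nat \<Rightarrow> real" where "g n = 1 + (1/2) ^ n" for n
  have g: "1 \<le> g n" "g n \<le> 2" "g (Suc n) < g n" for n
    by (auto simp: g_def power_le_one)
  define B where "B f n = insert \<phi> (canon ` f ` {..<n})" for f :: "nat \<Rightarrow> 'a" and n
  define P where "P f n x \<longleftrightarrow> norm x \<le> norm \<phi> + 1 \<and> norm (T x - y) \<le> (1/2) ^ n \<and>
    (\<forall>e\<in>span (B f n). \<forall>t. g (Suc n) * norm e \<le> g n * norm (e + t *\<^sub>R (canon x - \<phi>)))"
    for f n x
  have "\<exists>f. \<forall>n. P f n (f n)"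
  \<comment> \<open>\<open>P f n\<close> depends only on the values of \<open>f\<close> below
    \<open>n\<close>, which permits choice by course-of-values recursion.\<close>
  proof (rule dependent_wf_choice[of less_than])
    fix n f
    let ?e = "1 - g (Suc n) / g n"
    have "0 < ?e" "?e \<le> 1" using g[of n] g(1)[of "Suc n"] by auto
    then obtain x where "norm x \<le> norm \<phi> + 1" "norm (T x - y) \<le> (1/2) ^ n" and
      x: "\<And>e t. e \<in> span (B f n) \<Longrightarrow> (1 - ?e) * norm e \<le> norm (e + t *\<^sub>R (canon x - \<phi>))"
      using ex_next_term[OF y d d_le, of "B f n" ?e "(1/2) ^ n"] by (auto simp: B_def)
    moreover have "g (Suc n) * norm e \<le> g n * norm (e + t *\<^sub>R (canon x - \<phi>))"
      if "e \<in> span (B f n)" for e t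
      using x[OF that, of t] g(1)[of n] by (simp add: field_simps)
    ultimately show "\<exists>x. P f n x" unfolding P_def by blast
  next
    fix f f' :: "nat \<Rightarrow> 'a" and n x assume "\<And>z. (z, n) \<in> less_than \<Longrightarrow> f z = f' z"
    then have "B f n = B f' n" unfolding B_def by (auto simp: image_iff)
    then show "P f n x = P f' n x" unfolding P_def by simp
  qed simp
  then obtain x where x: "\<And>n. norm (x n) \<le> norm \<phi> + 1" "\<And>n. norm (T (x n) - y) \<le> (1/2) ^ n"
    "\<And>n e t. e \<in> span (B x n) \<Longrightarrow> g (Suc n) * norm e \<le> g n * norm (e + t *\<^sub>R (canon (x n) - \<phi>))"
    unfolding P_def by blast
  have B_mono: "span (B x n) \<subseteq> span (B x m)" if "n \<le> m" for n m
    using that by (intro span_mono) (auto simp: B_def)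
  have \<phi>_B: "\<phi> \<in> span (B x n)" for n by (intro span_base) (simp add: B_def)
  have x_B: "canon (x j) \<in> span (B x n)" if "j < n" for j n
    using that by (intro span_base) (simp add: B_def)
  have norm_le: "g m * norm e \<le> g n * norm (e + (\<Sum>j=n..<m. c j *\<^sub>R (canon (x j) - \<phi>)))"
    if "e \<in> span (B x n)" "n \<le> m" for e n m c
    using that(2)
  proof (induction m rule: dec_induct)
    case (step m)
    let ?s = "\<Sum>j=n..<m. c j *\<^sub>R (canon (x j) - \<phi>)"
    have "e + ?s \<in> span (B x m)"
      using that(1) B_mono[OF step(1)] \<phi>_B x_B
      by (intro span_add span_sum span_scale span_diff) auto
    from x(3)[OF this, of "c m"]
    have *: "g (Suc m) * norm (e + ?s) \<le> g m * norm (e + (\<Sum>j=n..<Suc m. c j *\<^sub>R (canon (x j) - \<phi>)))"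
      using step(1) by (simp add: add.assoc)
    have "g (Suc m) * (g m * norm e) \<le> g (Suc m) * (g n * norm (e + ?s))"
      using step.IH g(1)[of "Suc m"] by (intro mult_left_mono) auto
    also have "\<dots> \<le> g n * (g m * norm (e + (\<Sum>j=n..<Suc m. c j *\<^sub>R (canon (x j) - \<phi>))))"
      using mult_left_mono[OF *, of "g n"] g(1)[of n] by (simp add: mult.left_commute)
    finally show ?case
      using g(1)[of m] by (simp add: mult.left_commute[of _ "g m"])
  qed simp
  \<comment> \<open>Written in the basic sequence \<phi>, \<open>canon (x j) - \<phi>\<close>, the
    combination up to \<open>m\<close> loses its last terms by \<open>norm_le\<close>. What remains
    is the head plus \<phi> times the sum of the omitted coefficients.\<close>
  have key: "norm ((\<Sum>j<n. c j *\<^sub>R canon (x j)) + (\<Sum>j=n..<m. c j) *\<^sub>R \<phi>)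
      \<le> 2 * norm (\<Sum>j<m. c j *\<^sub>R x j)" if nm: "n \<le> m" for c n m
  proof -
    let ?e = "(\<Sum>j<n. c j *\<^sub>R canon (x j)) + (\<Sum>j=n..<m. c j) *\<^sub>R \<phi>"
    have "?e \<in> span (B x n)"
      using \<phi>_B x_B by (intro span_add span_sum span_scale) auto
    then have "g m * norm ?e \<le> g n * norm (?e + (\<Sum>j=n..<m. c j *\<^sub>R (canon (x j) - \<phi>)))"
      by (rule norm_le[OF _ nm])
    also have "?e + (\<Sum>j=n..<m. c j *\<^sub>R (canon (x j) - \<phi>)) = canon (\<Sum>j<m. c j *\<^sub>R x j)"
    proof -
      have "(\<Sum>j<m. c j *\<^sub>R canon (x j)) = (\<Sum>j<n. c j *\<^sub>R canon (x j)) + (\<Sum>j=n..<m. c j *\<^sub>R canon (x j))"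
        using nm by (simp add: lessThan_atLeast0 sum.atLeastLessThan_concat)
      then show ?thesis
        by (simp add: canon_sum_scaleR scaleR_diff_right sum_subtractf scaleR_sum_left)
    qed
    finally have "g m * norm ?e \<le> g n * norm (\<Sum>j<m. c j *\<^sub>R x j)" by simp
    moreover have "1 * norm ?e \<le> g m * norm ?e" by (intro mult_right_mono g) auto
    moreover have "g n * norm (\<Sum>j<m. c j *\<^sub>R x j) \<le> 2 * norm (\<Sum>j<m. c j *\<^sub>R x j)"
      by (intro mult_right_mono g) auto
    ultimately show ?thesis by linarith
  qed
  \<comment> \<open>The positive distance of \<phi> from the canonical image bounds the coefficient
    of \<phi> in \<open>key\<close>.\<close>
  have tail: "\<bar>\<Sum>j=n..<m. c j\<bar> \<le> 2 / d * norm (\<Sum>j<m. c j *\<^sub>R x j)" if nm: "n \<le> m" for c n m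
  proof -
    have "\<bar>\<Sum>j=n..<m. c j\<bar> * d \<le> norm ((\<Sum>j=n..<m. c j) *\<^sub>R \<phi> + canon (\<Sum>j<n. c j *\<^sub>R x j))"
      using d_le by (intro subspace_dist_scaleR[of "range canon"])
        (auto intro: linear_subspace_image[OF linear_canon])
    also have "\<dots> \<le> 2 * norm (\<Sum>j<m. c j *\<^sub>R x j)"
      using key[OF nm, of c] by (simp add: canon_sum_scaleR add.commute)
    finally show ?thesis using d by (simp add: field_simps)
  qed
  have "dominates x x"
  \<comment> \<open>The first 2 comes from \<open>key\<close>, the other term from removing the
    multiple of \<phi> by \<open>tail\<close>.\<close>
  proof (rule dominatesI[of "2 + 2 / d * norm \<phi>"])
    fix c :: "nat \<Rightarrow> real" and n m :: nat assume nm: "n \<le> m"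
    let ?v = "norm (\<Sum>j<m. c j *\<^sub>R x j)"
    have "norm (\<Sum>j<n. c j *\<^sub>R x j) = norm (\<Sum>j<n. c j *\<^sub>R canon (x j))"
      by (simp flip: canon_sum_scaleR)
    also have "\<dots> \<le> norm ((\<Sum>j<n. c j *\<^sub>R canon (x j)) + (\<Sum>j=n..<m. c j) *\<^sub>R \<phi>)
        + norm ((\<Sum>j=n..<m. c j) *\<^sub>R \<phi>)"
      using norm_triangle_ineq4[of "(\<Sum>j<n. c j *\<^sub>R canon (x j)) + (\<Sum>j=n..<m. c j) *\<^sub>R \<phi>"
          "(\<Sum>j=n..<m. c j) *\<^sub>R \<phi>"] by simp
    also have "\<dots> \<le> 2 * ?v + 2 / d * ?v * norm \<phi>"
      using key[OF nm, of c] mult_right_mono[OF tail[OF nm, of c], of "norm \<phi>"] by simp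
    finally show "norm (\<Sum>j<n. c j *\<^sub>R x j) \<le> (2 + 2 / d * norm \<phi>) * ?v"
      by (simp add: algebra_simps)
  qed (use d in simp)
  moreover have "dominates x (\<lambda>_. 1::real)"
  proof (rule dominatesI[of "4 / d"])
    fix c :: "nat \<Rightarrow> real" and n m :: nat assume nm: "n \<le> m"
    \<comment> \<open>Both sums on the right are tails in the sense of \<open>tail\<close>, the
      first with \<open>n = 0\<close>.\<close>
    have "(\<Sum>j<n. c j) = (\<Sum>j=0..<m. c j) - (\<Sum>j=n..<m. c j)"
      using nm by (simp add: lessThan_atLeast0 eq_diff_eq sum.atLeastLessThan_concat)
    then show "norm (\<Sum>j<n. c j *\<^sub>R (1::real)) \<le> 4 / d * norm (\<Sum>j<m. c j *\<^sub>R x j)"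
      using tail[OF nm, of c] tail[of 0 m c] by simp
  qed (use d in simp)
  ultimately show thesis using that x(1,2) by blast
qed

subsection \<open>Basic sequences and partial sum projections\<close>

lemma subspace_closure:
  fixes M :: "'a::real_normed_vector set"
  assumes M: "subspace M"
  shows "subspace (closure M)"
proof (rule subspaceI)
  show "0 \<in> closure M" using subspace_0[OF M] closure_subset by blast
  show "x + y \<in> closure M" if xy: "x \<in> closure M" "y \<in> closure M" for x y
  proof -
    obtain u v where "\<And>n. u n \<in> M" "u \<longlonglongrightarrow> x" "\<And>n. v n \<in> M" "v \<longlonglongrightarrow> y"
      using xy unfolding closure_sequential by blast
    then show ?thesis unfolding closure_sequential
      by (intro exI[of _ "\<lambda>n. u n + v n"]) (auto intro: tendsto_add subspace_add[OF M])
  qed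
  show "t *\<^sub>R x \<in> closure M" if x: "x \<in> closure M" for t x
  proof -
    obtain u where "\<And>n. u n \<in> M" "u \<longlonglongrightarrow> x"
      using x unfolding closure_sequential by blast
    then show ?thesis unfolding closure_sequential
      by (intro exI[of _ "\<lambda>n. t *\<^sub>R u n"]) (auto intro: tendsto_intros subspace_scale[OF M])
  qed
qed

lemma sum_single_coeff:
  fixes x :: "nat \<Rightarrow> 'a::real_vector"
  shows "j < n \<Longrightarrow> (\<Sum>i<n. (if i = j then 1 else 0 :: real) *\<^sub>R x i) = x j"
  by (subst sum.mono_neutral_right[of _ "{j}"]) auto

text \<open>The partial sums are eventually constant, so several vectors of the span can be expanded
  up to one common index.\<close>

lemma in_span_rangeE:
  fixes b :: "nat \<Rightarrow> 'a::real_vector"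
  assumes "v \<in> span (range b)"
  obtains c :: "nat \<Rightarrow> real" and N where "\<And>n. N \<le> n \<Longrightarrow> (\<Sum>j<n. c j *\<^sub>R b j) = v"
proof -
  let ?S = "{v. \<exists>(c::nat \<Rightarrow> real) N. \<forall>n\<ge>N. (\<Sum>j<n. c j *\<^sub>R b j) = v}"
  have "span (range b) \<subseteq> ?S"
  proof (rule span_minimal)
    have "\<exists>(c::nat \<Rightarrow> real) N. \<forall>n\<ge>N. (\<Sum>j<n. c j *\<^sub>R b j) = b i" for i
    proof (intro exI[of _ "\<lambda>j. if j = i then 1 else 0"] exI[of _ "Suc i"] allI impI)
      fix n assume "Suc i \<le> n"
      then show "(\<Sum>j<n. (if j = i then 1 else 0) *\<^sub>R b j) = b i"
        by (intro sum_single_coeff) simp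
    qed
    then show "range b \<subseteq> ?S" by auto
    show "subspace ?S"
    proof (rule subspaceI)
      show "0 \<in> ?S" by (auto intro!: exI[of _ "\<lambda>_. 0"])
      show "u + v \<in> ?S" if uv: "u \<in> ?S" "v \<in> ?S" for u v
      proof -
        obtain c N c' N' where "\<forall>n\<ge>N. (\<Sum>j<n. c j *\<^sub>R b j) = u" "\<forall>n\<ge>N'. (\<Sum>j<n. c' j *\<^sub>R b j) = v"
          using uv by auto
        then have "\<forall>n\<ge>max N N'. (\<Sum>j<n. (c j + c' j) *\<^sub>R b j) = u + v"
          by (auto simp: scaleR_add_left sum.distrib)
        then show ?thesis by (intro CollectI exI)
      qed
      show "t *\<^sub>R u \<in> ?S" if u: "u \<in> ?S" for t u
      proof -
        obtain c N where "\<forall>n\<ge>N. (\<Sum>j<n. c j *\<^sub>R b j) = u" using u by auto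
        then have "\<forall>n\<ge>N. (\<Sum>j<n. (t * c j) *\<^sub>R b j) = t *\<^sub>R u"
          by (auto simp flip: scaleR_scaleR scaleR_sum_right)
        then show ?thesis by (intro CollectI exI)
      qed
    qed
  qed
  with assms that show thesis by blast
qed

lemma sum_in_span_range: "(\<Sum>j<n. c j *\<^sub>R b j) \<in> span (range b)"
  by (intro span_sum span_scale span_base) auto

lemma sums_in_closure_span_range:
  fixes b :: "nat \<Rightarrow> 'a::real_normed_vector"
  assumes "(\<lambda>j. c j *\<^sub>R b j) sums z"
  shows "z \<in> closure (span (range b))"
  unfolding closure_sequential
proof (intro exI[of _ "\<lambda>n. \<Sum>j<n. c j *\<^sub>R b j"] conjI allI)
  show "(\<lambda>n. \<Sum>j<n. c j *\<^sub>R b j) \<longlonglongrightarrow> z" using assms by (simp add: sums_def)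
qed (rule sum_in_span_range)

text \<open>Grunblum's criterion. The uniform bound lets the coefficients of approximants from the
  span converge, and it controls the error of all partial sums at once.\<close>

lemma dominates_self_imp_basic_seq:
  fixes b :: "nat \<Rightarrow> 'a::banach"
  assumes "dominates b b" and nonzero: "\<And>j. b j \<noteq> 0"
  shows "basic_seq b"
  unfolding basic_seq_def
proof (intro ballI ex_ex1I)
  obtain C where C: "0 \<le> C" "\<And>(c::nat \<Rightarrow> real) n m. n \<le> m \<Longrightarrow>
     norm (\<Sum>j<n. c j *\<^sub>R b j) \<le> C * norm (\<Sum>j<m. c j *\<^sub>R b j)"
    using dominatesE[OF assms(1)] by blast
  {
    fix x c c' assume cc: "(\<lambda>j. c j *\<^sub>R b j) sums x" "(\<lambda>j. c' j *\<^sub>R b j) sums x"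
    define p where "p n = (\<Sum>j<n. (c j - c' j) *\<^sub>R b j)" for n
    \<comment> \<open>Each \<open>p n\<close> is bounded by \<open>C\<close> times the norms of all
      later \<open>p m\<close>, which tend to zero.\<close>
    have "p \<longlonglongrightarrow> 0"
      using sums_diff[OF cc] by (simp add: sums_def p_def[abs_def] scaleR_diff_left)
    then have "(\<lambda>m. C * norm (p m)) \<longlonglongrightarrow> 0"
      by (metis mult_zero_right norm_zero tendsto_mult_left tendsto_norm)
    then have "norm (p n) \<le> 0" for n
      by (rule LIMSEQ_le_const) (use C(2)[of n _ "\<lambda>j. c j - c' j"] in \<open>auto simp: p_def\<close>)
    then have p: "p n = 0" for n by simp
    have "(c j - c' j) *\<^sub>R b j = p (Suc j) - p j" for j by (simp add: p_def)
    then show "c = c'" using nonzero by (auto simp: p)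
  }
  fix x assume "x \<in> closure (span (range b))"
  then obtain z where z: "\<And>k. z k \<in> span (range b)" "z \<longlonglongrightarrow> x"
    unfolding closure_sequential by blast
  have "\<exists>(a::nat \<Rightarrow> real) N. \<forall>n\<ge>N. (\<Sum>j<n. a j *\<^sub>R b j) = z k" for k
    using in_span_rangeE[OF z(1)[of k]] by metis
  then obtain a :: "nat \<Rightarrow> nat \<Rightarrow> real" and N where
    a: "\<And>k n. N k \<le> n \<Longrightarrow> (\<Sum>j<n. a k j *\<^sub>R b j) = z k"
    by metis
  have diff: "norm (\<Sum>j<n. (a k j - a l j) *\<^sub>R b j) \<le> C * norm (z k - z l)" for k l n
  proof -
    let ?m = "max n (max (N k) (N l))"
    have "norm (\<Sum>j<n. (a k j - a l j) *\<^sub>R b j) \<le> C * norm (\<Sum>j<?m. (a k j - a l j) *\<^sub>R b j)"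
      by (rule C) simp
    also have "(\<Sum>j<?m. (a k j - a l j) *\<^sub>R b j) = z k - z l"
      by (simp add: scaleR_diff_left sum_subtractf a)
    finally show ?thesis .
  qed
  have coeff: "\<bar>a k j - a l j\<bar> * norm (b j) \<le> 2 * C * norm (z k - z l)" for k l j
  proof -
    let ?p = "\<lambda>n. \<Sum>j<n. (a k j - a l j) *\<^sub>R b j"
    have "\<bar>a k j - a l j\<bar> * norm (b j) = norm (?p (Suc j) - ?p j)" by simp
    also have "\<dots> \<le> norm (?p (Suc j)) + norm (?p j)" by (rule norm_triangle_ineq4)
    finally show ?thesis using diff[of k l "Suc j"] diff[of k l j] by linarith
  qed
  have "Cauchy (\<lambda>k. a k j)" for j
  proof (rule CauchyI)
    fix e :: real assume e: "0 < e"
    have nb: "0 < norm (b j)" using nonzero by simp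
    \<comment> \<open>The summand 1 avoids division by zero when \<open>C = 0\<close>.\<close>
    let ?d = "e * norm (b j) / (2 * C + 1)"
    have "0 < ?d" using e nb C(1) by (intro divide_pos_pos mult_pos_pos) auto
    then obtain M where M: "\<And>m n. m \<ge> M \<Longrightarrow> n \<ge> M \<Longrightarrow> norm (z m - z n) < ?d"
      using CauchyD[OF LIMSEQ_imp_Cauchy[OF z(2)]] by blast
    show "\<exists>M. \<forall>m\<ge>M. \<forall>n\<ge>M. norm (a m j - a n j) < e"
    proof (intro exI allI impI)
      fix m n assume mn: "M \<le> m" "M \<le> n"
      have "2 * C * norm (z m - z n) \<le> (2 * C + 1) * norm (z m - z n)"
        by (simp add: mult_right_mono)
      also have "\<dots> < (2 * C + 1) * ?d"
        using M[OF mn] C(1) by (intro mult_strict_left_mono) auto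
      also have "\<dots> = e * norm (b j)" using C(1) by simp
      finally have "\<bar>a m j - a n j\<bar> * norm (b j) < e * norm (b j)"
        using coeff[of m j n] by linarith
      then show "norm (a m j - a n j) < e" using nb by simp
    qed
  qed
  then have "\<exists>c. (\<lambda>k. a k j) \<longlonglongrightarrow> c" for j
    by (simp add: Cauchy_convergent_iff convergent_def)
  then obtain c where c: "\<And>j. (\<lambda>k. a k j) \<longlonglongrightarrow> c j" by metis
  have lim: "norm (\<Sum>j<n. (a k j - c j) *\<^sub>R b j) \<le> C * norm (z k - x)" for k n
  proof (rule LIMSEQ_le)
    show "(\<lambda>l. norm (\<Sum>j<n. (a k j - a l j) *\<^sub>R b j)) \<longlonglongrightarrow> norm (\<Sum>j<n. (a k j - c j) *\<^sub>R b j)"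
      by (intro tendsto_intros c)
    show "(\<lambda>l. C * norm (z k - z l)) \<longlonglongrightarrow> C * norm (z k - x)"
      by (intro tendsto_intros z)
  qed (use diff in blast)
  have "(\<lambda>j. c j *\<^sub>R b j) sums x"
    unfolding sums_def
  proof (rule LIMSEQ_I)
    fix e :: real assume e: "0 < e"
    then have "0 < e / (C + 1)" using C(1) by simp
    then obtain k where k: "norm (z k - x) < e / (C + 1)"
      using LIMSEQ_D[OF z(2)] by blast
    show "\<exists>n0. \<forall>n\<ge>n0. norm ((\<Sum>j<n. c j *\<^sub>R b j) - x) < e"
    proof (intro exI allI impI)
      fix n assume n: "N k \<le> n"
      \<comment> \<open>From \<open>N k\<close> on, the partial sums of the \<open>k\<close>-th
        approximant equal \<open>z k\<close>; the remaining term is controlled by \<open>lim\<close>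
        uniformly in \<open>n\<close>.\<close>
      have "(\<Sum>j<n. c j *\<^sub>R b j) - x = (z k - x) - (\<Sum>j<n. (a k j - c j) *\<^sub>R b j)"
        by (simp add: scaleR_diff_left sum_subtractf a[OF n])
      also have "norm \<dots> \<le> norm (z k - x) + C * norm (z k - x)"
        using lim[of k n] norm_triangle_ineq4[of "z k - x" "\<Sum>j<n. (a k j - c j) *\<^sub>R b j"] by linarith
      also have "\<dots> = (C + 1) * norm (z k - x)" by (simp add: algebra_simps)
      also have "\<dots> < e" using k C(1) by (simp add: field_simps)
      finally show "norm ((\<Sum>j<n. c j *\<^sub>R b j) - x) < e" .
    qed
  qed
  then show "\<exists>c. (\<lambda>j. c j *\<^sub>R b j) sums x" by blast
qed

text \<open>By Baire's theorem each \<^term>\<open>z\<close> in the closed span is a limit of vectors whose partial sums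
  are bounded by a fixed multiple of the norm of \<^term>\<open>z\<close>; iterating the approximation
  recovers \<^term>\<open>z\<close> itself, as in the open mapping theorem.  Pairing \<^term>\<open>b\<close> with \<^term>\<open>d\<close>
  treats both sequences at once.\<close>

lemma basic_seq_imp_dominates:
  fixes b :: "nat \<Rightarrow> 'a::banach" and d :: "nat \<Rightarrow> 'b::banach"
  assumes basic: "basic_seq b"
    and summable: "\<And>c :: nat \<Rightarrow> real. summable (\<lambda>j. c j *\<^sub>R b j) \<Longrightarrow> summable (\<lambda>j. c j *\<^sub>R d j)"
  shows "dominates b d"
proof -
  define Z where "Z = closure (span (range b))"
  have Z: "subspace Z" "closed Z" by (auto simp: Z_def subspace_closure)
  define coef where "coef z = (THE c::nat \<Rightarrow> real. (\<lambda>j. c j *\<^sub>R b j) sums z)" for z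
  have ex1: "\<exists>!c::nat \<Rightarrow> real. (\<lambda>j. c j *\<^sub>R b j) sums z" if "z \<in> Z" for z
    using basic that unfolding basic_seq_def Z_def by blast
  have coef_sums: "(\<lambda>j. coef z j *\<^sub>R b j) sums z" if "z \<in> Z" for z
    unfolding coef_def by (rule theI'[OF ex1[OF that]])
  have coef_eq: "coef z = c" if "(\<lambda>j. c j *\<^sub>R b j) sums z" for c z
    using ex1[of z] coef_sums[of z] that sums_in_closure_span_range[OF that] Z_def by blast
  have coef_diff: "coef (u - v) = (\<lambda>j. coef u j - coef v j)" if "u \<in> Z" "v \<in> Z" for u v
    using sums_diff[OF coef_sums[OF that(1)] coef_sums[OF that(2)]]
    by (intro coef_eq) (simp add: scaleR_diff_left)
  have coef_scale: "coef (t *\<^sub>R u) = (\<lambda>j. t * coef u j)" if "u \<in> Z" for t u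
    using sums_scaleR_right[OF coef_sums[OF that], of t] by (intro coef_eq) simp
  \<comment> \<open>Otherwise a unit sequence of coefficients would be a second expansion of
    0.\<close>
  have nonzero: "b j \<noteq> 0" for j
  proof
    assume "b j = 0"
    then have "(\<lambda>i. (if i = j then 1 else 0 :: real) *\<^sub>R b i) = (\<lambda>_. 0)" by auto
    then have "coef 0 = (\<lambda>i. if i = j then 1 else 0)" by (intro coef_eq) simp
    moreover have "coef 0 = (\<lambda>_. 0)" by (intro coef_eq) simp
    ultimately show False by (metis one_neq_zero)
  qed
  define D where "D j = (b j, d j)" for j
  define S where "S z n = (\<Sum>j<n. coef z j *\<^sub>R D j)" for z n
  have fst_S: "fst (S z n) = (\<Sum>j<n. coef z j *\<^sub>R b j)" for z n
    by (simp add: S_def D_def fst_sum)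
  have S_diff: "S (u - v) n = S u n - S v n" if "u \<in> Z" "v \<in> Z" for u v n
    by (simp add: S_def coef_diff[OF that] scaleR_diff_left sum_subtractf)
  have S_scale: "S (t *\<^sub>R u) n = t *\<^sub>R S u n" if "u \<in> Z" for t u n
    by (simp add: S_def coef_scale[OF that] scaleR_sum_right)
  have S_bounded: "\<exists>K::nat. \<forall>n. norm (S z n) \<le> real K" if z: "z \<in> Z" for z
  proof -
    have "summable (\<lambda>j. coef z j *\<^sub>R d j)"
      by (rule summable[OF sums_summable[OF coef_sums[OF z]]])
    then have "(\<lambda>n. (\<Sum>j<n. coef z j *\<^sub>R b j, \<Sum>j<n. coef z j *\<^sub>R d j))
        \<longlonglongrightarrow> (z, suminf (\<lambda>j. coef z j *\<^sub>R d j))"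
      using coef_sums[OF z] summable_LIMSEQ unfolding sums_def by (intro tendsto_Pair)
    moreover have "S z = (\<lambda>n. (\<Sum>j<n. coef z j *\<^sub>R b j, \<Sum>j<n. coef z j *\<^sub>R d j))"
      by (simp add: fun_eq_iff S_def D_def prod_eq_iff fst_sum snd_sum)
    ultimately have "convergent (S z)"
      unfolding convergent_def by (intro exI) simp
    then obtain K where "\<And>n. norm (S z n) \<le> K"
      using convergent_imp_Bseq[of "S z"] by (auto simp: Bseq_def)
    moreover obtain m :: nat where "K \<le> real m" using real_arch_simple by blast
    ultimately show ?thesis by (meson order_trans)
  qed
  define E where "E K = {z \<in> Z. \<forall>n. norm (S z n) \<le> real K}" for K :: nat
  \<comment> \<open>Baire's theorem in the complete space \<open>Z\<close>: the sets
    \<open>E K\<close> cover it, because partial sums of convergent series are bounded.\<close>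
  have "\<exists>K. (top_of_set Z) interior_of (Z \<inter> closure (E K)) \<noteq> {}"
  proof (rule ccontr)
    assume contra: "\<not> ?thesis"
    have "(top_of_set Z) interior_of (\<Union>K. Z \<inter> closure (E K)) = {}"
    proof (rule Baire_category_alt)
      show "completely_metrizable_space (top_of_set Z) \<or>
          locally_compact_space (top_of_set Z) \<and> regular_space (top_of_set Z)"
        using completely_metrizable_space_closedin[OF completely_metrizable_space_euclidean, of Z] Z(2)
        by simp
    qed (use contra in \<open>auto simp: closedin_closed_Int\<close>)
    moreover have "(\<Union>K. Z \<inter> closure (E K)) = Z"
      using S_bounded closure_subset[of "E _"] by (fastforce simp: E_def)
    ultimately have "Z = {}" by (metis interior_of_topspace topspace_euclidean_subtopology)
    with subspace_0[OF Z(1)] show False by simp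
  qed
  then obtain K z0 where "z0 \<in> (top_of_set Z) interior_of (Z \<inter> closure (E K))" by blast
  then obtain U where U: "openin (top_of_set Z) U" "z0 \<in> U" "U \<subseteq> closure (E K)"
    by (auto simp: interior_of_def)
  then obtain r where r: "0 < r" "ball z0 r \<inter> Z \<subseteq> U" and z0: "z0 \<in> Z"
    by (meson openin_contains_ball subset_iff openin_subset openin_imp_subset)
  \<comment> \<open>In \<open>approx\<close>, \<open>z\<close> is scaled by
    \<open>s = r / (2 * norm z)\<close> to fit into the ball about \<open>z0\<close>. A difference
    of two elements of \<open>E K\<close> has partial sums at most \<open>2 * K\<close>, and
    dividing by \<open>s\<close> gives \<open>L * norm z\<close>.\<close>
  define L where "L = 4 * real K / r"
  have L: "0 \<le> L" using r by (simp add: L_def)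
  have approx: "\<exists>y\<in>Z. (\<forall>n. norm (S y n) \<le> L * norm z) \<and> norm (z - y) < e"
    if z: "z \<in> Z" "z \<noteq> 0" and e: "0 < e" for z e
  proof -
    define s where "s = r / (2 * norm z)"
    have s: "0 < s" using r z by (simp add: s_def)
    have "norm (s *\<^sub>R z) < r" using r z by (simp add: s_def)
    then have "z0 + s *\<^sub>R z \<in> closure (E K)" "z0 \<in> closure (E K)"
      using r(1) U(3) z0 z by (auto intro!: subsetD[OF U(3)] subsetD[OF r(2)] subspace_add[OF Z(1)]
          subspace_scale[OF Z(1)] simp: dist_norm)
    moreover have "0 < s * e / 2" using s e by simp
    ultimately obtain y1 y2 where y: "y1 \<in> E K" "y2 \<in> E K"
      "norm (y1 - (z0 + s *\<^sub>R z)) < s * e / 2" "norm (y2 - z0) < s * e / 2"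
      unfolding closure_approachable dist_norm by meson
    then have yZ: "y1 \<in> Z" "y2 \<in> Z" and Sy: "\<And>n. norm (S y1 n) \<le> K" "\<And>n. norm (S y2 n) \<le> K"
      by (auto simp: E_def)
    define y where "y = (1 / s) *\<^sub>R (y1 - y2)"
    have "norm (S y n) \<le> L * norm z" for n
    proof -
      have "norm (S y n) = (1 / s) * norm (S y1 n - S y2 n)"
        using s yZ by (simp add: y_def S_scale S_diff subspace_diff[OF Z(1)])
      also have "\<dots> \<le> (1 / s) * (2 * real K)"
        using s norm_triangle_ineq4[of "S y1 n" "S y2 n"] Sy(1)[of n] Sy(2)[of n]
        by (intro mult_left_mono) auto
      finally show ?thesis using r z by (simp add: s_def L_def field_simps)
    qed
    moreover have "norm (z - y) < e"
    proof -
      have "s *\<^sub>R (z - y) = (y2 - z0) - (y1 - (z0 + s *\<^sub>R z))"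
        using s by (simp add: y_def scaleR_diff_right)
      then have "s * norm (z - y) = norm ((y2 - z0) - (y1 - (z0 + s *\<^sub>R z)))"
        using s by (metis abs_of_pos norm_scaleR)
      also have "\<dots> < s * e"
        using y(3,4) norm_triangle_ineq4[of "y2 - z0" "y1 - (z0 + s *\<^sub>R z)"] by linarith
      finally show ?thesis using s by simp
    qed
    moreover have "y \<in> Z" unfolding y_def
      by (intro subspace_scale[OF Z(1)] subspace_diff[OF Z(1)] yZ)
    ultimately show ?thesis by blast
  qed
  have S_le: "norm (S z n) \<le> 2 * L * norm z" if z: "z \<in> Z" for z n
  proof (cases "z = 0")
    case True
    have "coef 0 = (\<lambda>_. 0)" by (intro coef_eq) simp
    with True show ?thesis by (simp add: S_def)
  next
    case False
    define l where "l = norm z"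
    have l: "0 < l" using False by (simp add: l_def)
    \<comment> \<open>The \<open>v k\<close> are the successive remainders, halved in size at each
      step; the last clause pins \<open>v 0\<close> to \<open>z\<close>.\<close>
    let ?P = "\<lambda>k v. v \<in> Z \<and> norm v \<le> l * (1/2) ^ k \<and> (k = 0 \<longrightarrow> v = z)"
    have "\<exists>v. \<forall>k. ?P k (v k) \<and> (\<forall>n. norm (S (v k - v (Suc k)) n) \<le> L * (l * (1/2) ^ k))"
    proof (rule dependent_nat_choice)
      show "\<exists>v. ?P 0 v" using z by (auto simp: l_def)
    next
      fix v k assume v: "?P k v"
      show "\<exists>w. ?P (Suc k) w \<and> (\<forall>n. norm (S (v - w) n) \<le> L * (l * (1/2) ^ k))"
      proof (cases "v = 0")
        case True
        have "S 0 n = 0" for n using S_scale[OF z, of 0 n] by simp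
        with True show ?thesis
          using l L subspace_0[OF Z(1)] by (intro exI[of _ 0]) simp
      next
        case False
        have "0 < l * (1/2) ^ Suc k" using l by simp
        then obtain y where y: "y \<in> Z" "\<And>n. norm (S y n) \<le> L * norm v"
          "norm (v - y) < l * (1/2) ^ Suc k"
          using approx[of v "l * (1/2) ^ Suc k"] v False by blast
        have "norm (S y n) \<le> L * (l * (1/2) ^ k)" for n
          using y(2)[of n] v L by (meson mult_left_mono order_trans)
        then show ?thesis
          using y v by (intro exI[of _ "v - y"]) (auto intro: subspace_diff[OF Z(1)])
      qed
    qed
    then obtain v where v: "\<And>k. v k \<in> Z" "\<And>k. norm (v k) \<le> l * (1/2) ^ k" "v 0 = z"
      and vS: "\<And>k n. norm (S (v k - v (Suc k)) n) \<le> L * l * (1/2) ^ k"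
      unfolding mult.assoc by blast
    define y where "y k = v k - v (Suc k)" for k
    have yZ: "y k \<in> Z" for k unfolding y_def by (intro subspace_diff[OF Z(1)] v)
    have yS: "norm (S (y k) n) \<le> L * l * (1/2) ^ k" for k n unfolding y_def by (rule vS)
    have y_sum: "(\<Sum>i<k. y i) = z - v k" for k
      unfolding y_def by (simp add: sum_lessThan_telescope' v(3))
    have geo: "(\<lambda>i. L * l * (1/2) ^ (i + k)) sums (2 * L * l * (1/2) ^ k)" for k
      using sums_mult[OF geometric_sums[of "1/2::real"], of "L * l * (1/2) ^ k"]
      by (simp add: power_add mult_ac)
    have sum_S: "summable (\<lambda>i. S (y i) n)" for n
      using geo[of 0] yS by (intro summable_comparison_test[OF _ sums_summable]) auto
    have tail: "norm (\<Sum>i. S (y (i + k)) n) \<le> 2 * L * l * (1/2) ^ k" for k n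
      using norm_suminf_le[of "\<lambda>i. S (y (i + k)) n" "\<lambda>i. L * l * (1/2) ^ (i + k)"]
        yS[of "_ + k" n] sums_summable[OF geo[of k]] sums_unique[OF geo[of k]] by simp
    \<comment> \<open>A coefficient times \<open>D j\<close> is a difference of consecutive partial
      sums; as \<open>b j\<close> is nonzero, geometric decay passes to the coefficients.\<close>
    have sum_coef: "summable (\<lambda>i. coef (y i) j)" for j
    proof (rule summable_comparison_test)
      have "summable (\<lambda>i. 2 * (L * l * (1/2) ^ i) / norm (b j))"
        using sums_summable[OF geo[of 0]] by (intro summable_divide summable_mult) simp
      then show "summable (\<lambda>i. 2 * (L * l * (1/2) ^ i) / norm (b j))" .
      have "norm (coef (y i) j) \<le> 2 * (L * l * (1/2) ^ i) / norm (b j)" for i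
      proof -
        have "\<bar>coef (y i) j\<bar> * norm (b j) \<le> \<bar>coef (y i) j\<bar> * norm (D j)"
          by (intro mult_left_mono) (auto simp: D_def norm_Pair1 norm_fst_le[of "b j" "d j"])
        also have "\<dots> = norm (S (y i) (Suc j) - S (y i) j)" by (simp add: S_def)
        also have "\<dots> \<le> 2 * (L * l * (1/2) ^ i)"
          using norm_triangle_ineq4[of "S (y i) (Suc j)" "S (y i) j"] yS[of i "Suc j"] yS[of i j]
          by linarith
        finally show ?thesis using nonzero[of j] by (simp add: field_simps)
      qed
      then show "\<exists>N. \<forall>i\<ge>N. norm (coef (y i) j) \<le> 2 * (L * l * (1/2) ^ i) / norm (b j)" by blast
    qed
    define e where "e j = (\<Sum>i. coef (y i) j)" for j
    have W: "(\<Sum>i. S (y i) n) = (\<Sum>j<n. e j *\<^sub>R D j)" for n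
    proof -
      have "(\<lambda>i. S (y i) n) sums (\<Sum>j<n. e j *\<^sub>R D j)"
        unfolding S_def e_def by (intro sums_sum sums_scaleR_left summable_sums sum_coef)
      then show ?thesis by (simp add: sums_iff)
    qed
    have split: "(\<Sum>j<n. e j *\<^sub>R D j) = (\<Sum>i<k. S (y i) n) + (\<Sum>i. S (y (i + k)) n)" for n k
      using suminf_split_initial_segment[OF sum_S[of n], of k] W[of n] by simp
    \<comment> \<open>Cut the series of the \<open>y i\<close> at \<open>k\<close>: the tail is
      small uniformly in \<open>n\<close>, and the finitely many other expansions converge as
      \<open>n\<close> grows.\<close>
    have "(\<lambda>j. e j *\<^sub>R b j) sums z"
      unfolding sums_def
    proof (rule LIMSEQ_I)
      fix \<epsilon> :: real assume \<epsilon>: "0 < \<epsilon>"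
      have "(\<lambda>k. (l + 2 * L * l) * (1/2) ^ k) \<longlonglongrightarrow> (l + 2 * L * l) * 0"
        by (intro tendsto_mult_left LIMSEQ_power_zero) simp
      then have "\<forall>\<^sub>F k in sequentially. (l + 2 * L * l) * (1/2) ^ k < \<epsilon> / 2"
        using \<epsilon> by (intro order_tendstoD) auto
      then obtain k where k: "(l + 2 * L * l) * (1/2) ^ k < \<epsilon> / 2"
        by (auto simp: eventually_sequentially)
      have "(\<lambda>n. \<Sum>i<k. fst (S (y i) n)) \<longlonglongrightarrow> (\<Sum>i<k. y i)"
        using coef_sums[OF yZ] by (intro tendsto_sum) (simp add: fst_S sums_def)
      then obtain n0 where n0: "\<And>n. n \<ge> n0 \<Longrightarrow> norm ((\<Sum>i<k. fst (S (y i) n)) - (\<Sum>i<k. y i)) < \<epsilon> / 2"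
        using LIMSEQ_D[of _ _ "\<epsilon> / 2"] \<epsilon> by (metis half_gt_zero)
      show "\<exists>n0. \<forall>n\<ge>n0. norm ((\<Sum>j<n. e j *\<^sub>R b j) - z) < \<epsilon>"
      proof (intro exI allI impI)
        fix n assume n: "n0 \<le> n"
        let ?t = "\<Sum>i. S (y (i + k)) n"
        have "(\<Sum>j<n. e j *\<^sub>R b j) = fst (\<Sum>j<n. e j *\<^sub>R D j)"
          by (simp add: D_def fst_sum)
        also have "\<dots> = (\<Sum>i<k. fst (S (y i) n)) + fst ?t"
          by (simp add: split[of n k] fst_sum)
        finally have eq: "(\<Sum>j<n. e j *\<^sub>R b j) - z
            = ((\<Sum>i<k. fst (S (y i) n)) - (\<Sum>i<k. y i)) + (fst ?t - v k)"
          by (simp add: y_sum)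
        have "norm ((\<Sum>j<n. e j *\<^sub>R b j) - z)
            \<le> norm ((\<Sum>i<k. fst (S (y i) n)) - (\<Sum>i<k. y i)) + (norm (fst ?t) + norm (v k))"
          unfolding eq using norm_triangle_ineq[of "(\<Sum>i<k. fst (S (y i) n)) - (\<Sum>i<k. y i)" "fst ?t - v k"]
            norm_triangle_ineq4[of "fst ?t" "v k"] by linarith
        moreover have "norm (fst ?t) \<le> 2 * L * l * (1/2) ^ k"
          using tail[of k n] norm_fst_le[of "fst ?t" "snd ?t"] by simp
        moreover have "(l + 2 * L * l) * (1/2) ^ k = l * (1/2) ^ k + 2 * L * l * (1/2) ^ k"
          by (simp add: algebra_simps)
        ultimately show "norm ((\<Sum>j<n. e j *\<^sub>R b j) - z) < \<epsilon>"
          using n0[OF n] v(2)[of k] k by linarith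
      qed
    qed
    \<comment> \<open>By uniqueness \<open>S z n\<close> is the series of the
      \<open>S (y i) n\<close>, so \<open>tail\<close> with \<open>k = 0\<close> is the desired
      bound.\<close>
    then have "coef z = e" by (rule coef_eq)
    then show ?thesis using tail[of 0 n] W[of n] by (simp add: S_def l_def)
  qed
  show ?thesis
  proof (rule dominatesI)
    show "0 \<le> 2 * L" using L by simp
    fix c :: "nat \<Rightarrow> real" and n m :: nat assume nm: "n \<le> m"
    let ?z = "\<Sum>j<m. c j *\<^sub>R b j"
    have "(\<lambda>j. (if j < m then c j else 0) *\<^sub>R b j) sums (\<Sum>j<m. (if j < m then c j else 0) *\<^sub>R b j)"
      by (rule sums_finite) auto
    then have "coef ?z = (\<lambda>j. if j < m then c j else 0)" by (intro coef_eq) simp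
    then have "S ?z n = (\<Sum>j<n. c j *\<^sub>R D j)"
      unfolding S_def using nm by (intro sum.cong) auto
    then have "(\<Sum>j<n. c j *\<^sub>R d j) = snd (S ?z n)" by (simp add: D_def snd_sum)
    then have "norm (\<Sum>j<n. c j *\<^sub>R d j) \<le> norm (S ?z n)"
      using norm_snd_le[of "snd (S ?z n)" "fst (S ?z n)"] by simp
    also have "\<dots> \<le> 2 * L * norm ?z"
      by (rule S_le) (use sum_in_span_range[of c b m] closure_subset in \<open>auto simp: Z_def\<close>)
    finally show "norm (\<Sum>j<n. c j *\<^sub>R d j) \<le> 2 * L * norm ?z" .
  qed
qed

subsection \<open>Wide sequences\<close>

lemma dominates_one_lower_bound:
  fixes x :: "nat \<Rightarrow> 'a::real_normed_vector"
  assumes "dominates x (\<lambda>_. 1::real)"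
  obtains a where "0 < a" "\<And>(c::nat \<Rightarrow> real) n m. n \<le> m \<Longrightarrow>
    a * \<bar>\<Sum>j<n. c j\<bar> \<le> norm (\<Sum>j<m. c j *\<^sub>R x j)"
proof -
  obtain C where C: "0 \<le> C" "\<And>(c::nat \<Rightarrow> real) n m. n \<le> m \<Longrightarrow>
     norm (\<Sum>j<n. c j *\<^sub>R (1::real)) \<le> C * norm (\<Sum>j<m. c j *\<^sub>R x j)"
    using dominatesE[OF assms] by blast
  \<comment> \<open>\<open>C\<close> is only known to be nonnegative; \<open>C + 1\<close> can be
    inverted.\<close>
  have "1 / (C + 1) * \<bar>\<Sum>j<n. c j\<bar> \<le> norm (\<Sum>j<m. c j *\<^sub>R x j)" if "n \<le> m" for c :: "nat \<Rightarrow> real" and n m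
  proof -
    have "\<bar>\<Sum>j<n. c j\<bar> \<le> C * norm (\<Sum>j<m. c j *\<^sub>R x j)"
      using C(2)[OF that, of c] by simp
    also have "\<dots> \<le> (C + 1) * norm (\<Sum>j<m. c j *\<^sub>R x j)" by (simp add: mult_right_mono)
    finally show ?thesis using C(1) by (simp add: field_simps)
  qed
  moreover have "0 < 1 / (C + 1)" using C(1) by simp
  ultimately show thesis using that by blast
qed

lemma dominates_imp_wide_s:
  fixes x :: "nat \<Rightarrow> 'a::banach"
  assumes bound: "\<And>n. norm (x n) \<le> M" and xx: "dominates x x" and x1: "dominates x (\<lambda>_. 1::real)"
  shows "wide_s x"
proof -
  obtain a where a: "0 < a" "\<And>(c::nat \<Rightarrow> real) n m. n \<le> m \<Longrightarrow>
    a * \<bar>\<Sum>j<n. c j\<bar> \<le> norm (\<Sum>j<m. c j *\<^sub>R x j)"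
    using dominates_one_lower_bound[OF x1] by blast
  have lower: "a \<le> norm (x j)" for j
    using a(2)[of "Suc j" "Suc j" "\<lambda>i. if i = j then 1 else 0"]
    by (simp add: sum_single_coeff[of j "Suc j"] del: sum.lessThan_Suc)
  have "x j \<noteq> 0" for j using lower[of j] a(1) by auto
  then have "basic_seq x" by (rule dominates_self_imp_basic_seq[OF xx])
  moreover have "summable c" if c: "summable (\<lambda>j. c j *\<^sub>R x j)" for c :: "nat \<Rightarrow> real"
    unfolding summable_Cauchy
  proof (intro allI impI)
    fix e :: real assume "0 < e"
    then have "0 < a * e" using a(1) by simp
    then obtain N where N: "\<And>m n. m \<ge> N \<Longrightarrow> norm (\<Sum>j=m..<n. c j *\<^sub>R x j) < a * e"
      using c unfolding summable_Cauchy by meson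
    have "norm (sum c {m..<n}) < e" if m: "m \<ge> N" for m n
    proof -
      \<comment> \<open>Zeros below \<open>m\<close> turn the block from \<open>m\<close> to
        \<open>n\<close> into an initial segment.\<close>
      let ?c = "\<lambda>j. if m \<le> j then c j else 0"
      have sums: "(\<Sum>j<n. ?c j *\<^sub>R x j) = (\<Sum>j=m..<n. c j *\<^sub>R x j)" "(\<Sum>j<n. ?c j) = sum c {m..<n}"
        by (rule sum.mono_neutral_cong_right; auto)+
      have "a * \<bar>sum c {m..<n}\<bar> < a * e"
        using a(2)[of n n ?c] N[OF m, of n] unfolding sums by linarith
      then show ?thesis using a(1) by simp
    qed
    then show "\<exists>N. \<forall>m\<ge>N. \<forall>n. norm (sum c {m..<n}) < e" by blast
  qed
  ultimately show ?thesis
    unfolding wide_s_def semi_normalized_def using lower a(1) bound by blast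
qed

lemma dominates_imp_wide_c_differences:
  fixes x :: "nat \<Rightarrow> 'a::banach"
  assumes bound: "\<And>n. norm (x n) \<le> M" and xx: "dominates x x" and x1: "dominates x (\<lambda>_. 1::real)"
  shows "wide_c (\<lambda>j. x (Suc j) - x j)"
proof -
  let ?e = "\<lambda>j. x (Suc j) - x j"
  obtain C where C: "0 \<le> C" "\<And>(c::nat \<Rightarrow> real) n m. n \<le> m \<Longrightarrow>
     norm (\<Sum>j<n. c j *\<^sub>R x j) \<le> C * norm (\<Sum>j<m. c j *\<^sub>R x j)"
    using dominatesE[OF xx] by blast
  obtain a where a: "0 < a" "\<And>(c::nat \<Rightarrow> real) n m. n \<le> m \<Longrightarrow>
    a * \<bar>\<Sum>j<n. c j\<bar> \<le> norm (\<Sum>j<m. c j *\<^sub>R x j)"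
    using dominates_one_lower_bound[OF x1] by blast
  have M: "0 \<le> M" using bound[of 0] norm_ge_zero order_trans by blast
  text \<open>Summation by parts expresses combinations of the differences through \<^term>\<open>x\<close>.\<close>
  define p where "p c j = (case j of 0 \<Rightarrow> 0 | Suc i \<Rightarrow> c i) - c j" for c :: "nat \<Rightarrow> real" and j
  have sum_p: "(\<Sum>j<Suc n. p c j) = - c n"
    and sum_px: "(\<Sum>j<Suc n. p c j *\<^sub>R x j) = (\<Sum>j<n. c j *\<^sub>R ?e j) - c n *\<^sub>R x n" for c n
    by (induction n) (simp_all add: p_def algebra_simps)
  have coeff: "a * \<bar>c n\<bar> \<le> norm (\<Sum>j<m. c j *\<^sub>R ?e j)"
    and partial: "norm ((\<Sum>j<n. c j *\<^sub>R ?e j) - c n *\<^sub>R x n) \<le> C * norm (\<Sum>j<m. c j *\<^sub>R ?e j)"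
    if nm: "n < m" for c :: "nat \<Rightarrow> real" and n m
  proof -
    \<comment> \<open>Truncation removes the boundary term at \<open>m\<close>, so the combination
      of differences is exactly one of \<open>x\<close> of length \<open>Suc m\<close>.\<close>
    let ?c = "\<lambda>j. if j < m then c j else 0"
    have eq: "(\<Sum>j<n. ?c j *\<^sub>R ?e j) = (\<Sum>j<n. c j *\<^sub>R ?e j)" if "n \<le> m" for n
      using that by (intro sum.cong) auto
    have "(\<Sum>j<Suc m. p ?c j *\<^sub>R x j) = (\<Sum>j<m. c j *\<^sub>R ?e j)"
      unfolding sum_px by (simp add: eq)
    then show "a * \<bar>c n\<bar> \<le> norm (\<Sum>j<m. c j *\<^sub>R ?e j)"
      "norm ((\<Sum>j<n. c j *\<^sub>R ?e j) - c n *\<^sub>R x n) \<le> C * norm (\<Sum>j<m. c j *\<^sub>R ?e j)"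
      using a(2)[of "Suc n" "Suc m" "p ?c"] C(2)[of "Suc n" "Suc m" "p ?c"] nm
      unfolding sum_p sum_px by (simp_all add: eq)
  qed
  have "dominates ?e ?e"
  \<comment> \<open>\<open>C\<close> comes from \<open>partial\<close>, \<open>M / a\<close> from
    the boundary term \<open>c n *\<^sub>R x n\<close>, and 1 covers the case
    \<open>n = m\<close>.\<close>
  proof (rule dominatesI[of "C + M / a + 1"])
    show "0 \<le> C + M / a + 1" using C(1) M a(1) by simp
    fix c :: "nat \<Rightarrow> real" and n m :: nat assume nm: "n \<le> m"
    let ?v = "norm (\<Sum>j<m. c j *\<^sub>R ?e j)"
    show "norm (\<Sum>j<n. c j *\<^sub>R ?e j) \<le> (C + M / a + 1) * ?v"
    proof (cases "n = m")
      case True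
      have "1 * ?v \<le> (C + M / a + 1) * ?v" using C(1) M a(1) by (intro mult_right_mono) auto
      with True show ?thesis by simp
    next
      case False
      with nm have nm: "n < m" by simp
      have "norm (\<Sum>j<n. c j *\<^sub>R ?e j) \<le> norm ((\<Sum>j<n. c j *\<^sub>R ?e j) - c n *\<^sub>R x n) + norm (c n *\<^sub>R x n)"
        using norm_triangle_ineq[of "(\<Sum>j<n. c j *\<^sub>R ?e j) - c n *\<^sub>R x n" "c n *\<^sub>R x n"] by simp
      also have "\<dots> \<le> C * ?v + (?v / a) * M"
      proof -
        have "\<bar>c n\<bar> \<le> ?v / a" using coeff[OF nm, of c] a(1) by (simp add: field_simps)
        then have "norm (c n *\<^sub>R x n) \<le> (?v / a) * M"
          using bound[of n] a(1) by (simp add: mult_mono del: times_divide_eq_left)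
        with partial[OF nm, of c] show ?thesis by linarith
      qed
      also have "\<dots> \<le> (C + M / a + 1) * ?v" by (simp add: algebra_simps)
      finally show ?thesis .
    qed
  qed
  moreover have lower: "a \<le> norm (?e j)" for j
    using coeff[of j "Suc j" "\<lambda>i. if i = j then 1 else 0"]
    by (simp add: sum_single_coeff[of j "Suc j" ?e] del: sum.lessThan_Suc)
  moreover have "?e j \<noteq> 0" for j using lower[of j] a(1) by (metis norm_zero not_le)
  ultimately have "basic_seq ?e" by (intro dominates_self_imp_basic_seq)
  moreover have "norm (x k - x l) \<le> 2 * M" for k l
    using norm_triangle_ineq4[of "x k" "x l"] bound[of k] bound[of l] by linarith
  ultimately show ?thesis
    unfolding wide_c_def semi_normalized_def sum_lessThan_telescope using lower a(1) by blast
qed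

subsection \<open>Tauberian operators\<close>

text \<open>The cluster functional of the sequence is mapped to the norm limit \<open>y\<close>,
  which lies in the target space; being Tauberian forces it to come from a vector
  \<open>u\<close>.\<close>

lemma tauberian_weak_limit:
  fixes T :: "'a::real_normed_vector \<Rightarrow>\<^sub>L 'b::real_normed_vector"
  assumes T: "tauberian T" and bound: "\<And>n. norm (x n) \<le> M" and lim: "(\<lambda>n. T (x n)) \<longlonglongrightarrow> y"
  obtains u where "\<And>(f :: 'a \<Rightarrow>\<^sub>L real) r. (\<lambda>n. f (x n)) \<longlonglongrightarrow> r \<Longrightarrow> f u = r"
proof -
  obtain \<phi> :: "('a \<Rightarrow>\<^sub>L real) \<Rightarrow>\<^sub>L real" where
    \<phi>: "\<And>f r. (\<lambda>n. blinfun_apply f (x n)) \<longlonglongrightarrow> r \<Longrightarrow> \<phi> f = r"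
    using ex_weak_cluster_functional[of x M] bound by blast
  have "bidual_op T \<phi> = canon y"
  proof (rule blinfun_eqI)
    fix g :: "'b \<Rightarrow>\<^sub>L real"
    have "(\<lambda>n. (g o\<^sub>L T) (x n)) \<longlonglongrightarrow> g y"
      using blinfun.tendsto[OF tendsto_const lim, of g] by simp
    from \<phi>[OF this] show "bidual_op T \<phi> g = canon y g" by simp
  qed
  with T obtain u where "\<phi> = canon u" unfolding tauberian_def by blast
  with \<phi> show thesis by (intro that[of u]) simp
qed

section \<open>Closed tail spans and the converse implications\<close>

lemma in_closure_span_tail:
  fixes e :: "nat \<Rightarrow> 'a::real_normed_vector"
  assumes "\<And>f :: 'a \<Rightarrow>\<^sub>L real. (\<And>j. k \<le> j \<Longrightarrow> f (e j) = 0) \<Longrightarrow> f v = 0"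
  shows "v \<in> closure (span (range (\<lambda>i. e (k + i))))"
proof (rule in_closure_subspace_by_functionals)
  fix f :: "'a \<Rightarrow>\<^sub>L real" assume f: "\<And>u. u \<in> span (range (\<lambda>i. e (k + i))) \<Longrightarrow> f u = 0"
  have "f (e j) = 0" if "k \<le> j" for j
    using f[OF span_base[OF rangeI], of "j - k"] that by simp
  then show "f v = 0" by (rule assms)
qed simp

text \<open>For finite tails this is the partial sum bound for the spliced coefficients; the
  inequality is closed in \<open>v\<close>.\<close>

lemma norm_head_le_tail:
  fixes e :: "nat \<Rightarrow> 'a::real_normed_vector"
  assumes C: "\<And>(c::nat \<Rightarrow> real) n m. n \<le> m \<Longrightarrow>
     norm (\<Sum>j<n. c j *\<^sub>R e j) \<le> C * norm (\<Sum>j<m. c j *\<^sub>R e j)"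
    and v: "v \<in> closure (span (range (\<lambda>i. e (k + i))))"
  shows "norm (\<Sum>j<k. c j *\<^sub>R e j) \<le> C * norm ((\<Sum>j<k. c j *\<^sub>R e j) + v)"
proof -
  let ?w = "\<Sum>j<k. c j *\<^sub>R e j"
  let ?S = "{v. norm ?w \<le> C * norm (?w + v)}"
  have "span (range (\<lambda>i. e (k + i))) \<subseteq> ?S"
  proof
    fix v assume "v \<in> span (range (\<lambda>i. e (k + i)))"
    then obtain c' :: "nat \<Rightarrow> real" and m where v: "(\<Sum>j<m. c' j *\<^sub>R e (k + j)) = v"
      using in_span_rangeE[of v "\<lambda>i. e (k + i)"] by (metis order_refl)
    let ?c = "\<lambda>j. if j < k then c j else c' (j - k)"
    have "(\<Sum>j<k + m. ?c j *\<^sub>R e j) = ?w + v"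
      by (simp add: v[symmetric] lessThan_atLeast0
          sum.atLeastLessThan_concat[of 0 k "k + m", symmetric] sum.atLeastLessThan_shift_0[of _ k])
    moreover have "(\<Sum>j<k. ?c j *\<^sub>R e j) = ?w" by (intro sum.cong) auto
    ultimately show "v \<in> ?S" using C[of k "k + m" ?c] by simp
  qed
  moreover have "closed ?S" by (intro closed_Collect_le continuous_intros)
  ultimately have "closure (span (range (\<lambda>i. e (k + i)))) \<subseteq> ?S" by (rule closure_minimal)
  with v show ?thesis by blast
qed

text \<open>For a Tauberian \<open>T\<close> the partial sums would have a weak limit
  \<open>u\<close>, the basis bound would improve this to norm convergence, and the terms could not
  stay bounded away from zero.\<close>

lemma wide_c_imp_not_tauberian:
  fixes T :: "'a::banach \<Rightarrow>\<^sub>L 'b::banach"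
  assumes e: "wide_c e" and summable: "summable (\<lambda>j. norm (T (e j)))"
  shows "\<not> tauberian T"
proof
  assume T: "tauberian T"
  define x where "x n = (\<Sum>j<n. e j)" for n
  have x_Suc: "x (Suc n) = x n + e n" for n by (simp add: x_def)
  obtain M a where M: "\<And>n. norm (x n) \<le> M" and a: "0 < a" "\<And>j. a \<le> norm (e j)"
    and basic: "basic_seq e"
    using e unfolding wide_c_def semi_normalized_def x_def by blast
  obtain C where C: "0 \<le> C" "\<And>(c::nat \<Rightarrow> real) n m. n \<le> m \<Longrightarrow>
     norm (\<Sum>j<n. c j *\<^sub>R e j) \<le> C * norm (\<Sum>j<m. c j *\<^sub>R e j)"
    using dominatesE[OF basic_seq_imp_dominates[OF basic, of e]] by blast
  have "(\<lambda>n. T (x n)) \<longlonglongrightarrow> (\<Sum>j. T (e j))"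
    using summable_LIMSEQ[OF summable_norm_cancel[OF summable]] by (simp add: x_def blinfun.sum_right)
  then obtain u where u: "\<And>(f :: 'a \<Rightarrow>\<^sub>L real) r. (\<lambda>n. f (x n)) \<longlonglongrightarrow> r \<Longrightarrow> f u = r"
    using tauberian_weak_limit[of T x M, OF T M] by blast
  have tail: "u - x k \<in> closure (span (range (\<lambda>i. e (k + i))))" for k
  proof (rule in_closure_span_tail)
    fix f :: "'a \<Rightarrow>\<^sub>L real" assume f: "\<And>j. k \<le> j \<Longrightarrow> f (e j) = 0"
    \<comment> \<open>A functional that kills the tail is constant along the partial sums from
      \<open>k\<close> on, hence takes the same value at \<open>u\<close>.\<close>
    have "f (x n) = f (x k)" if "k \<le> n" for n
      using that by (induction rule: dec_induct) (simp_all add: x_Suc blinfun.add_right f)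
    then have "(\<lambda>n. f (x n)) \<longlonglongrightarrow> f (x k)"
      by (intro tendsto_eventually eventually_sequentiallyI[of k])
    from u[OF this] show "f (u - x k) = 0" by (simp add: blinfun.diff_right)
  qed
  have "e sums u"
    unfolding sums_def x_def[symmetric]
  proof (rule LIMSEQ_I)
    fix \<epsilon> :: real assume "0 < \<epsilon>"
    then have "0 < \<epsilon> / (C + 1)" using C(1) by simp
    moreover have "u \<in> closure (span (range e))" using tail[of 0] by (simp add: x_def)
    ultimately obtain q where q: "q \<in> span (range e)" "norm (q - u) < \<epsilon> / (C + 1)"
      unfolding closure_approachable dist_norm by blast
    obtain c :: "nat \<Rightarrow> real" and N where c: "\<And>n. N \<le> n \<Longrightarrow> (\<Sum>j<n. c j *\<^sub>R e j) = q"
      using in_span_rangeE[OF q(1)] by blast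
    show "\<exists>N. \<forall>k\<ge>N. norm (x k - u) < \<epsilon>"
    proof (intro exI allI impI)
      fix k assume k: "N \<le> k"
      \<comment> \<open>Splits \<open>q - u\<close> into the head \<open>q - x k\<close> and the
        tail \<open>x k - u\<close>, so the head bound applies.\<close>
      have w: "(\<Sum>j<k. (c j - 1) *\<^sub>R e j) = q - x k"
        by (simp add: scaleR_diff_left sum_subtractf c[OF k] x_def)
      have "x k - u \<in> closure (span (range (\<lambda>i. e (k + i))))"
        using subspace_neg[OF subspace_closure[OF subspace_span] tail[of k]] by simp
      from norm_head_le_tail[OF C(2) this, of "\<lambda>j. c j - 1"]
      have "norm (q - x k) \<le> C * norm (q - u)" by (simp add: w)
      moreover have "norm (x k - u) \<le> norm (q - u) + norm (q - x k)"
        using norm_triangle_ineq4[of "q - u" "q - x k"] by simp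
      ultimately have "norm (x k - u) \<le> (C + 1) * norm (q - u)" by (simp add: algebra_simps)
      also have "\<dots> < \<epsilon>" using q(2) C(1) by (simp add: field_simps)
      finally show "norm (x k - u) < \<epsilon>" .
    qed
  qed
  then have "e \<longlonglongrightarrow> 0" by (intro summable_LIMSEQ_zero sums_summable)
  then obtain j where "norm (e j) < a" using LIMSEQ_D[of e 0 a] a(1) by auto
  with a(2)[of j] show False by simp
qed

text \<open>For a Tauberian \<open>T\<close> a weak limit \<open>u\<close> would lie in all closed
  tail spans and so vanish, whereas a functional constant and positive on the sequence takes that
  same value at \<open>u\<close>.\<close>

lemma wide_s_imp_not_tauberian:
  fixes T :: "'a::banach \<Rightarrow>\<^sub>L 'b::banach"
  assumes x: "wide_s x" and conv: "convergent (\<lambda>j. T (x j))"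
  shows "\<not> tauberian T"
proof
  assume T: "tauberian T"
  obtain M where M: "\<And>n. norm (x n) \<le> M" and basic: "basic_seq x"
    and sumc: "\<And>c :: nat \<Rightarrow> real. summable (\<lambda>j. c j *\<^sub>R x j) \<Longrightarrow> summable c"
    using x unfolding wide_s_def semi_normalized_def by blast
  obtain C where C: "0 \<le> C" "\<And>(c::nat \<Rightarrow> real) n m. n \<le> m \<Longrightarrow>
     norm (\<Sum>j<n. c j *\<^sub>R x j) \<le> C * norm (\<Sum>j<m. c j *\<^sub>R x j)"
    using dominatesE[OF basic_seq_imp_dominates[OF basic, of x]] by blast
  have "dominates x (\<lambda>_. 1::real)"
    using sumc by (intro basic_seq_imp_dominates[OF basic]) simp
  then obtain a where a: "0 < a" "\<And>(c::nat \<Rightarrow> real) n m. n \<le> m \<Longrightarrow>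
    a * \<bar>\<Sum>j<n. c j\<bar> \<le> norm (\<Sum>j<m. c j *\<^sub>R x j)"
    using dominates_one_lower_bound by blast
  obtain y where "(\<lambda>n. T (x n)) \<longlonglongrightarrow> y" using conv by (auto simp: convergent_def)
  then obtain u where u: "\<And>(f :: 'a \<Rightarrow>\<^sub>L real) r. (\<lambda>n. f (x n)) \<longlonglongrightarrow> r \<Longrightarrow> f u = r"
    using tauberian_weak_limit[of T x M, OF T M] by blast
  have tail: "u \<in> closure (span (range (\<lambda>i. x (k + i))))" for k
  proof (rule in_closure_span_tail)
    fix f :: "'a \<Rightarrow>\<^sub>L real" assume "\<And>j. k \<le> j \<Longrightarrow> f (x j) = 0"
    then have "(\<lambda>n. f (x n)) \<longlonglongrightarrow> 0"
      by (intro tendsto_eventually) (auto simp: eventually_sequentially)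
    then show "f u = 0" by (rule u)
  qed
  \<comment> \<open>An approximant \<open>q\<close> of \<open>u\<close> is a head and
    \<open>- u\<close> a tail beyond it, so \<open>norm q\<close> is at most \<open>C\<close> times
    their distance.\<close>
  have "norm u \<le> 0 + \<epsilon>" if "0 < \<epsilon>" for \<epsilon>
  proof -
    have "0 < \<epsilon> / (C + 1)" using C(1) that by simp
    moreover have "u \<in> closure (span (range x))" using tail[of 0] by simp
    ultimately obtain q where q: "q \<in> span (range x)" "norm (q - u) < \<epsilon> / (C + 1)"
      unfolding closure_approachable dist_norm by blast
    obtain c :: "nat \<Rightarrow> real" and N where c: "(\<Sum>j<N. c j *\<^sub>R x j) = q"
      using in_span_rangeE[OF q(1)] by (metis order_refl)
    have "- u \<in> closure (span (range (\<lambda>i. x (N + i))))"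
      by (rule subspace_neg[OF subspace_closure[OF subspace_span] tail])
    from norm_head_le_tail[OF C(2) this, of c]
    have "norm q \<le> C * norm (q - u)" by (simp add: c)
    moreover have "norm u \<le> norm q + norm (q - u)"
      using norm_triangle_ineq4[of q "q - u"] by simp
    ultimately have "norm u \<le> (C + 1) * norm (q - u)" by (simp add: algebra_simps)
    also have "\<dots> < \<epsilon>" using q(2) C(1) by (simp add: field_simps)
    finally show ?thesis by simp
  qed
  then have "u = 0" using field_le_epsilon[of "norm u" 0] by simp
  \<comment> \<open>In terms of \<open>x\<close>, the vector \<open>x 0 - v\<close> has coefficient
    sum 1 (the \<open>c'\<close> below), so it has norm at least \<open>a\<close>. Separation then
    gives a functional constant on \<open>x\<close>.\<close>
  have "a \<le> norm (x 0 - v)" if v_span: "v \<in> span (range (\<lambda>j. x j - x 0))" for v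
  proof -
    obtain c :: "nat \<Rightarrow> real" and N where c: "\<And>n. N \<le> n \<Longrightarrow> (\<Sum>j<n. c j *\<^sub>R (x j - x 0)) = v"
      using in_span_rangeE[OF v_span] by blast
    have v: "(\<Sum>j<Suc N. c j *\<^sub>R (x j - x 0)) = v" by (rule c) simp
    define c' where "c' j = (if j = 0 then 1 + sum c {..<Suc N} else 0) - c j" for j
    have "sum c' {..<Suc N} = 1"
      unfolding c'_def sum_subtractf by (simp add: sum.delta del: sum.lessThan_Suc)
    moreover have "(\<Sum>j<Suc N. c' j *\<^sub>R x j) = x 0 - v"
    proof -
      have "(\<Sum>j<Suc N. (if j = 0 then 1 + sum c {..<Suc N} else 0) *\<^sub>R x j) = (1 + sum c {..<Suc N}) *\<^sub>R x 0"
        by (subst sum.mono_neutral_right[of _ "{0}"]) auto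
      then show ?thesis
        unfolding c'_def scaleR_diff_left sum_subtractf
        by (simp add: v[symmetric] scaleR_diff_right sum_subtractf scaleR_add_left scaleR_sum_left
            del: sum.lessThan_Suc)
    qed
    ultimately show ?thesis using a(2)[of "Suc N" "Suc N" c'] by simp
  qed
  then obtain f :: "'a \<Rightarrow>\<^sub>L real" where
    f: "\<And>v. v \<in> span (range (\<lambda>j. x j - x 0)) \<Longrightarrow> f v = 0" "a \<le> f (x 0)"
    using ex_blinfun_separating_subspace[OF subspace_span less_imp_le[OF a(1)]] by blast
  have "f (x n) = f (x 0)" for n
    using f(1)[OF span_base, of "x n - x 0"] by (simp add: blinfun.diff_right)
  then have "(\<lambda>n. f (x n)) = (\<lambda>_. f (x 0))" by (rule ext)
  then have "f u = f (x 0)" by (intro u) (metis tendsto_const)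
  with f(2) a(1) \<open>u = 0\<close> show False by simp
qed

theorem theorem5:
  fixes T :: "'a::banach \<Rightarrow>\<^sub>L 'b::banach"
  shows "(\<not> tauberian T \<longleftrightarrow> (\<exists>x. wide_s x \<and> convergent (\<lambda>j. T (x j))))
       \<and> (\<not> tauberian T \<longleftrightarrow> (\<exists>e. wide_c e \<and> summable (\<lambda>j. norm (T (e j)))))"
proof -
  \<comment> \<open>One sequence serves both statements: \<open>x\<close> itself, and its
    differences, whose images are summable because \<open>T (x n)\<close> converges geometrically
    fast.\<close>
  have "(\<exists>x. wide_s x \<and> convergent (\<lambda>j. T (x j))) \<and> (\<exists>e. wide_c e \<and> summable (\<lambda>j. norm (T (e j))))"
    if T: "\<not> tauberian T"
  proof -
    obtain x :: "nat \<Rightarrow> 'a" and y M where x: "\<And>n. norm (x n) \<le> M"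
      "\<And>n. norm (T (x n) - y) \<le> (1/2) ^ n" "dominates x x" "dominates x (\<lambda>_. 1::real)"
      by (rule not_tauberian_imp_sequence[OF T], rule that)
    have "(\<lambda>n. T (x n) - y) \<longlonglongrightarrow> 0"
      by (rule Lim_null_comparison[of _ "\<lambda>n. (1/2) ^ n"]) (auto intro: always_eventually x(2) LIMSEQ_power_zero)
    then have "convergent (\<lambda>j. T (x j))"
      unfolding convergent_def using LIM_zero_iff by blast
    moreover have "summable (\<lambda>j. norm (T (x (Suc j) - x j)))"
    proof (rule summable_comparison_test')
      show "summable (\<lambda>j. 2 * (1/2::real) ^ j)" by (intro summable_mult summable_geometric) simp
      fix j :: nat
      have "norm (T (x (Suc j) - x j)) = norm ((T (x (Suc j)) - y) - (T (x j) - y))"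
        by (simp add: blinfun.diff_right)
      also have "\<dots> \<le> (1/2) ^ Suc j + (1/2) ^ j"
        using norm_triangle_ineq4[of "T (x (Suc j)) - y" "T (x j) - y"] x(2)[of "Suc j"] x(2)[of j]
        by linarith
      also have "\<dots> \<le> 2 * (1/2) ^ j" by simp
      finally show "norm (norm (T (x (Suc j) - x j))) \<le> 2 * (1/2) ^ j" by simp
    qed
    ultimately show ?thesis
      using dominates_imp_wide_s[OF x(1,3,4)] dominates_imp_wide_c_differences[OF x(1,3,4)] by blast
  qed
  with wide_s_imp_not_tauberian[of _ T] wide_c_imp_not_tauberian[of _ T] show ?thesis by blast
qed

end
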